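(* For every infinite sequence $\mathcal S$ of elementary foldings, the decorated folding tiling $T_{\mathcal S}$ and the undecorated folding tiling $T'_{\mathcal S}$ are mutually locally derivable (MLD).
   Context: Grid: let $\xi_1=(0,-2\sqrt3)$ and let $\xi_2,\xi_3$ be its counterclockwise rotations by $2\pi/3$ and $4\pi/3$. For $i\in\{1,2,3\}$, $n\in\mathbb Z$ put $\ell_{i,n}=\{x\in\mathbb R^2:(x,\xi_i)=3n+1\}$. The union $\mathcal L$ of all $\ell_{i,n}$ is a triangular grid whose smallest triangles (unit triangles) are regular of side $1$; unit edges are the sides of unit triangles. A unit triangle is positive if its vertex opposite its horizontal side lies above it, negative otherwise. $O$ is the origin and $T_0$ is the positive unit triangle centered at $O$; $(-2)^kT_0$ is its image under the homothety with center $O$ and ratio $(-2)^k$. Folding patterns: an elementary folding folds a paper regular triangle of side $2a$ along its three midsegments onto its central triangle of side $a$; it is a folding up ($+$) if all three folds go through the upper half-space of $\mathbb R^3$ and a folding down ($-$) if all go through the lower half-space. When unfolded, fold lines of a folding up become valleys and those of a folding down become peaks. For a finite sequence $(a_1,\dots,a_k)$ take the paper triangle $(-2)^kT_0$, perform $a_k$ first (onto $(-2)^{k-1}T_0$), then $a_{k-1}$, …, finally $a_1$ (onto $T_0$), then unfold; valleys are colored red and peaks blue. For an infinite sequence $\mathcal S=(a_i)_{i\ge1}$, $P_{\mathcal S}$ is the red/blue coloring of all unit edges of $\mathcal L$ in which each edge gets its color from the pattern of $(a_1,\dots,a_k)$ for any $k$ with the edge interior to $(-2)^kT_0$. The (decorated)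 folding tiling $T_{\mathcal S}$ is the tiling by the unit triangles of $\mathcal L$, each tile labeled by its orientation, its number of red sides in $P_{\mathcal S}$, and, when this number is $1$ or $2$, a decoration marking the side whose color differs from the other two. The undecorated folding tiling $T'_{\mathcal S}$ is obtained by removing these decorations, i.e. each tile is labeled only by its orientation and its number of red sides. MLD: a tiling (or pattern) $B$ is locally derivable from $A$ if there is $r>0$ such that whenever the restrictions of $A$ to the $r$-balls around two points $x,y$ coincide up to the translation by $y-x$, the local structures of $B$ at $x$ and $y$ coincide up to the same translation; $A$ and $B$ are MLD if each is locally derivable from the other. *)

theory Defs
  imports "HOL-Analysis.Analysis"
begin

type_synonym plane = "real ^ 2"

definition rot :: "real \<Rightarrow> plane \<Rightarrow> plane" where
  "rot \<theta> v = vector [cos \<theta> * v $ 1 - sin \<theta> * v $ 2, sin \<theta> * v $ 1 + cos \<theta> * v $ 2]"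

definition xi :: "nat \<Rightarrow> plane" where
  "xi i = rot (2 * pi * (real i - 1) / 3) (vector [0, - 2 * sqrt 3])"

definition grid_line :: "nat \<Rightarrow> int \<Rightarrow> plane set" where
  "grid_line i n = {x. x \<bullet> xi i = 3 * real_of_int n + 1}"

definition grid :: "plane set" where
  "grid = (\<Union>i\<in>{1,2,3}. \<Union>n. grid_line i n)"

definition regular_unit :: "plane \<Rightarrow> plane \<Rightarrow> plane \<Rightarrow> bool" where
  "regular_unit a b c \<longleftrightarrow> dist a b = 1 \<and> dist b c = 1 \<and> dist c a = 1"

definition unit_triangles :: "plane set set" where
  "unit_triangles = {convex hull {a, b, c} | a b c. regular_unit a b c \<and>
     closed_segment a b \<union> closed_segment b c \<union> closed_segment c a \<subseteq> grid}"

datatype orientation = Positive | Negative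

definition orientation_of :: "plane set \<Rightarrow> orientation" where
  "orientation_of T =
     (if \<exists>a b c. regular_unit a b c \<and> T = convex hull {a, b, c} \<and> a $ 2 = b $ 2 \<and> c $ 2 > a $ 2
      then Positive else Negative)"

definition T0 :: "plane set" where
  "T0 = convex hull {vector [- 1/2, - sqrt 3 / 6], vector [1/2, - sqrt 3 / 6], vector [0, sqrt 3 / 3]}"

definition tri :: "nat \<Rightarrow> plane set" where
  "tri k = (\<lambda>x. (- 2) ^ k *\<^sub>R x) ` T0"


text \<open>
  The elementary folding of the triangle \<^term>\<open>tri (Suc k)\<close> onto its central triangle
  \<^term>\<open>tri k\<close>.  Since \<^term>\<open>T0\<close> is cut out by the inequalities \<open>x \<bullet> xi i \<le> 1\<close>, the
  midsegments of \<^term>\<open>tri (Suc k)\<close>, i.e. the sides of \<^term>\<open>tri k\<close>, lie on the lines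
  \<open>x \<bullet> xi i = (- 2) ^ k\<close>; the corner triangle cut off by such a line is its part on the
  other side from the origin, and folding moves it by the reflection in that line.
\<close>

definition fold_line :: "nat \<Rightarrow> nat \<Rightarrow> plane set" where
  "fold_line k i = {x. x \<bullet> xi i = (- 2) ^ k}"

definition midsegment :: "nat \<Rightarrow> nat \<Rightarrow> plane set" where
  "midsegment k i = tri k \<inter> fold_line k i"

definition corner :: "nat \<Rightarrow> nat \<Rightarrow> plane set" where
  "corner k i = {x \<in> tri (Suc k). (x \<bullet> xi i) / (- 2) ^ k > 1}"

definition mirror :: "nat \<Rightarrow> nat \<Rightarrow> plane \<Rightarrow> plane" where
  "mirror k i x = x - (2 * (x \<bullet> xi i - (- 2) ^ k) / (xi i \<bullet> xi i)) *\<^sub>R xi i"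

text \<open>
  While the paper is being folded flat, a point of the paper is described by its current
  position in the plane together with a Boolean telling whether the originally upper face of
  the paper faces up at that point.
\<close>

definition fold_layer :: "nat \<Rightarrow> plane \<times> bool \<Rightarrow> plane \<times> bool" where
  "fold_layer k = (\<lambda>(p, up).
     if p \<in> corner k 1 then (mirror k 1 p, \<not> up)
     else if p \<in> corner k 2 then (mirror k 2 p, \<not> up)
     else if p \<in> corner k 3 then (mirror k 3 p, \<not> up)
     else (p, up))"

datatype folding = Up | Down

datatype color = Red | Blue

text \<open>
  A sequence \<open>a\<^sub>1, a\<^sub>2, \<dots>\<close> of elementary foldings is a function \<open>S\<close> with \<open>S m = a\<^sub>m\<^sub>+\<^sub>1\<close>, so that
  \<open>S m\<close> folds \<^term>\<open>tri (Suc m)\<close> onto \<^term>\<open>tri m\<close>.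

  \<open>crease S k (p, up)\<close> is the crease produced by performing \<open>S (k - 1), \<dots>, S 0\<close>, in this
  order, at a point of a sheet that lies at position \<open>p\<close> of \<^term>\<open>tri k\<close> and whose originally
  upper face faces up iff \<open>up\<close>.  Folding up a layer whose upper face faces up, or folding down a
  layer whose upper face faces down, brings two parts of the upper face together and yields a
  valley (red); in the other two cases the crease is a peak (blue).
\<close>

primrec crease :: "(nat \<Rightarrow> folding) \<Rightarrow> nat \<Rightarrow> plane \<times> bool \<Rightarrow> color option" where
  "crease S 0 l = None"
| "crease S (Suc k) l =
     (if fst l \<in> (\<Union>i\<in>{1,2,3}. midsegment k i)
      then Some (if (S k = Up) = snd l then Red else Blue)
      else crease S k (fold_layer k l))"

text \<open>
  \<open>e\<close> has color \<open>c\<close> in the unfolded pattern of the finite sequence \<open>S 0, \<dots>, S (k - 1)\<close>.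
  End points of an edge are excluded, since edges of both colors may meet there.
\<close>

definition finite_pattern :: "(nat \<Rightarrow> folding) \<Rightarrow> nat \<Rightarrow> plane set \<Rightarrow> color \<Rightarrow> bool" where
  "finite_pattern S k e c \<longleftrightarrow> (\<forall>x\<in>rel_interior e. crease S k (x, True) = Some c)"

text \<open>
  The choice of \<open>k\<close> is immaterial by lemma \<open>finite_pattern_indep\<close> below.
\<close>

definition folding_pattern :: "(nat \<Rightarrow> folding) \<Rightarrow> plane set \<Rightarrow> color" where
  "folding_pattern S e =
     (THE c. \<exists>k. rel_interior e \<subseteq> interior (tri k) \<and> finite_pattern S k e c)"


record tile =
  support :: "plane set"
  orient :: orientation
  reds :: nat
  mark :: "plane set option"

definition red_sides :: "(nat \<Rightarrow> folding) \<Rightarrow> plane set \<Rightarrow> nat" where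
  "red_sides S T = card {e. e edge_of T \<and> folding_pattern S e = Red}"

definition marked_side :: "(nat \<Rightarrow> folding) \<Rightarrow> plane set \<Rightarrow> plane set option" where
  "marked_side S T =
     (if red_sides S T \<in> {1, 2}
      then Some (THE e. e edge_of T \<and>
             (\<forall>e'. e' edge_of T \<and> e' \<noteq> e \<longrightarrow> folding_pattern S e' \<noteq> folding_pattern S e))
      else None)"

definition folding_tiling :: "(nat \<Rightarrow> folding) \<Rightarrow> tile set" where
  "folding_tiling S =
     (\<lambda>T. \<lparr>support = T, orient = orientation_of T, reds = red_sides S T, mark = marked_side S T\<rparr>)
       ` unit_triangles"

definition undecorated_folding_tiling :: "(nat \<Rightarrow> folding) \<Rightarrow> tile set" where
  "undecorated_folding_tiling S = (\<lambda>t. t\<lparr>mark := None\<rparr>) ` folding_tiling S"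


definition translate :: "plane \<Rightarrow> tile \<Rightarrow> tile" where
  "translate v t = t\<lparr>support := (+) v ` support t, mark := map_option ((`) ((+) v)) (mark t)\<rparr>"

definition patch :: "tile set \<Rightarrow> plane set \<Rightarrow> tile set" where
  "patch A D = {t \<in> A. support t \<inter> D \<noteq> {}}"

definition locally_derivable :: "tile set \<Rightarrow> tile set \<Rightarrow> bool" where
  "locally_derivable B A \<longleftrightarrow> (\<exists>r>0. \<forall>x y.
     translate (y - x) ` patch A (cball x r) = patch A (cball y r) \<longrightarrow>
     translate (y - x) ` patch B {x} = patch B {y})"

definition MLD :: "tile set \<Rightarrow> tile set \<Rightarrow> bool" where
  "MLD A B \<longleftrightarrow> locally_derivable A B \<and> locally_derivable B A"


lemma cos_sin_thirds:
  "cos (2 * pi / 3) = - 1 / 2" "sin (2 * pi / 3) = sqrt 3 / 2"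
  "cos (4 * pi / 3) = - 1 / 2" "sin (4 * pi / 3) = - sqrt 3 / 2"
proof -
  show "cos (2 * pi / 3) = - 1 / 2" "sin (2 * pi / 3) = sqrt 3 / 2"
    by (simp_all add: cos_120 sin_120)
  have e: "4 * pi / 3 = pi / 3 + pi" by simp
  show "cos (4 * pi / 3) = - 1 / 2" "sin (4 * pi / 3) = - sqrt 3 / 2"
    unfolding e cos_periodic_pi sin_periodic_pi by (simp_all add: cos_60 sin_60)
qed

lemma xi_simps:
  "xi 1 = vector [0, - 2 * sqrt 3]" "xi 2 = vector [3, sqrt 3]" "xi 3 = vector [- 3, sqrt 3]"
proof -
  show "xi 1 = vector [0, - 2 * sqrt 3]"
    by (simp add: xi_def rot_def)
  show "xi 2 = vector [3, sqrt 3]"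
    unfolding xi_def rot_def using cos_sin_thirds(1,2)
    by (simp del: divide_eq_eq_numeral1 eq_divide_eq_numeral1)
  show "xi 3 = vector [- 3, sqrt 3]"
    unfolding xi_def rot_def using cos_sin_thirds(3,4)
    by (simp del: divide_eq_eq_numeral1 eq_divide_eq_numeral1)
qed

lemma inner_xi:
  "x \<bullet> xi 1 = - 2 * sqrt 3 * x $ 2"
  "x \<bullet> xi 2 = 3 * x $ 1 + sqrt 3 * x $ 2"
  "x \<bullet> xi 3 = - 3 * x $ 1 + sqrt 3 * x $ 2"
  unfolding xi_simps by (simp_all add: inner_vec_def sum_2)

lemma T0_halfspaces:
  assumes "i \<in> {1,2,3}"
  shows "T0 \<subseteq> {x. x \<bullet> xi i \<le> 1}"
proof -
  have "{vector [- 1/2, - sqrt 3 / 6], vector [1/2, - sqrt 3 / 6], vector [0, sqrt 3 / 3]}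
          \<subseteq> {x. x \<bullet> xi i \<le> 1}"
    using assms by (auto simp: inner_xi inner_xi(1)[simplified] mult.assoc)
  moreover have "convex {x. x \<bullet> xi i \<le> 1}"
    using convex_halfspace_le[of "xi i" 1] by (simp add: inner_commute)
  ultimately show ?thesis
    unfolding T0_def by (rule hull_minimal)
qed

lemma tri_halfspaces:
  assumes "i \<in> {1,2,3}"
  shows "tri k \<subseteq> {x. (x \<bullet> xi i) / (- 2) ^ k \<le> 1}"
  using T0_halfspaces[OF assms] by (auto simp: tri_def)

lemma interior_tri_halfspaces:
  assumes "i \<in> {1,2,3}" "x \<in> interior (tri k)"
  shows "(x \<bullet> xi i) / (- 2) ^ k < 1"
proof -
  have xi: "xi i \<noteq> 0"
    using assms(1) by (auto simp: xi_simps xi_simps(1)[simplified] vec_eq_iff forall_2)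
  let ?a = "(1 / (- 2) ^ k) *\<^sub>R xi i"
  have "tri k \<subseteq> {x. ?a \<bullet> x \<le> 1}"
    using tri_halfspaces[OF assms(1), of k] by (simp add: inner_commute)
  hence "x \<in> interior {x. ?a \<bullet> x \<le> 1}"
    using assms(2) interior_mono by blast
  moreover have "?a \<noteq> 0" using xi by simp
  ultimately show ?thesis
    using interior_halfspace_le[of ?a 1] by (simp add: inner_commute)
qed

lemma halfspaces_Suc:
  assumes "\<forall>i\<in>{1,2,3}. (x \<bullet> xi i) / (- 2) ^ k < 1"
  shows "\<forall>i\<in>{1,2,3}. (x \<bullet> xi i) / (- 2) ^ Suc k < 1"
proof -
  have s: "x \<bullet> xi 1 / (- 2) ^ k + x \<bullet> xi 2 / (- 2) ^ k + x \<bullet> xi 3 / (- 2) ^ k = 0"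
    unfolding inner_xi add_divide_distrib[symmetric] by simp
  have aux: "- a / 2 < 1 \<and> - b / 2 < 1 \<and> - c / 2 < 1"
    if "a + b + c = 0" "a < 1" "b < 1" "c < 1" for a b c :: real
    using that by linarith
  have h: "(x \<bullet> xi i) / (- 2) ^ Suc k = - (x \<bullet> xi i / (- 2) ^ k) / 2" for i
    by simp
  have "x \<bullet> xi 1 / (- 2) ^ k < 1" "x \<bullet> xi 2 / (- 2) ^ k < 1" "x \<bullet> xi 3 / (- 2) ^ k < 1"
    using assms by blast+
  with s have "- (x \<bullet> xi 1 / (- 2) ^ k) / 2 < 1" "- (x \<bullet> xi 2 / (- 2) ^ k) / 2 < 1"
    "- (x \<bullet> xi 3 / (- 2) ^ k) / 2 < 1"
    using aux[of "x \<bullet> xi 1 / (- 2) ^ k" "x \<bullet> xi 2 / (- 2) ^ k" "x \<bullet> xi 3 / (- 2) ^ k"]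
    by blast+
  thus ?thesis unfolding h by blast
qed

lemma crease_Suc:
  assumes "\<forall>i\<in>{1,2,3}. (x \<bullet> xi i) / (- 2) ^ k < 1"
  shows "crease S (Suc k) (x, up) = crease S k (x, up)"
proof -
  have "x \<notin> midsegment k i" if "i \<in> {1,2,3}" for i
  proof
    assume "x \<in> midsegment k i"
    hence "(x \<bullet> xi i) / (- 2) ^ k = 1"
      by (simp add: midsegment_def fold_line_def)
    moreover have "(x \<bullet> xi i) / (- 2) ^ k < 1" using assms that by blast
    ultimately show False by linarith
  qed
  moreover have "x \<notin> corner k i" if "i \<in> {1,2,3}" for i
    using assms that unfolding corner_def by force
  ultimately show ?thesis
    by (simp add: fold_layer_def)
qed

lemma crease_stable:
  assumes "x \<in> interior (tri k)" "k \<le> m"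
  shows "crease S m (x, up) = crease S k (x, up)"
proof -
  have "(\<forall>i\<in>{1,2,3}. (x \<bullet> xi i) / (- 2) ^ m < 1) \<and> crease S m (x, up) = crease S k (x, up)"
    using assms(2)
  proof (induction m rule: dec_induct)
    case base
    show ?case using interior_tri_halfspaces[OF _ assms(1)] by blast
  next
    case (step m)
    then show ?case using halfspaces_Suc crease_Suc by metis
  qed
  thus ?thesis by blast
qed

lemma finite_pattern_indep:
  assumes "rel_interior e \<subseteq> interior (tri k)" "rel_interior e \<subseteq> interior (tri m)"
  shows "finite_pattern S k e c \<longleftrightarrow> finite_pattern S m e c"
proof -
  have "crease S k (x, True) = crease S m (x, True)" if "x \<in> rel_interior e" for x
    using that assms crease_stable[of x k m S True] crease_stable[of x m k S True]
    by (cases "k \<le> m") auto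
  thus ?thesis by (simp add: finite_pattern_def)
qed

end

theory Submission
  imports Defs
begin

text \<open>
  The last folding performed, \<open>S 0\<close>, creases exactly the middle edges of the triangles of side 2, in
  one color for the triangles oriented like \<^term>\<open>tri 1\<close> and in the other color for the rest; all
  earlier foldings crease whole edges of length 2. Hence a positive tile has 3 red sides (0 if
  \<open>S 0 = Down\<close>) iff it is the central tile of a triangle of side 2, and the number of red sides locates
  the grid of side 2. The sides of such a triangle have one color each, and its three corner tiles reveal
  the number of red sides among each pair of them, hence the color of every side. So all edge colors,
  and with them the decorations, are determined by the red-side counts of nearby tiles.
\<close>

text \<open>The vector between two points with matching patches is an arbitrary real vector; nothing
  says beforehand that it respects the grid, let alone the grid of side 2. Positive tiles settle
  this: none can be translated onto a negative tile, so the vector is an integer shift of indices,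
  and one matched central tile makes both components even. The rule for central tiles is the same at
  both places because \<open>S 0\<close> belongs to the whole tiling. The radius is independent of
  \<open>S\<close>: the terms \<open>S 1, S 2, ...\<close> enter only as unknown colors, one for
  each edge of length 2.

  The claims about colors come from following a point through the reflections. Rounded coordinates
  carry enough information: as - 2 is 1 modulo 3, all fold lines of stage at least \<open>m\<close>
  are grid lines of level \<open>m\<close>, and the reflections permute these. So the two halves of
  an edge of length 2 move together, and the parity of the number of times a layer is turned over
  can be read off from the triangle in which it started.\<close>

subsection \<open>Colors of the creases\<close>

(* Keeps the index in "xi 1" from being rewritten to "Suc 0". *)
declare One_nat_def [simp del]

section \<open>Signed coordinates and a single folding step\<close>

definition scaled :: "nat \<Rightarrow> nat \<Rightarrow> plane \<Rightarrow> real" where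
  "scaled k i x = (x \<bullet> xi i) / (- 2) ^ k"

definition inside :: "nat \<Rightarrow> plane \<Rightarrow> bool" where
  "inside k x \<longleftrightarrow> (\<forall>i\<in>{1,2,3}. scaled k i x < 1)"

lemma inner_xi_sum: "x \<bullet> xi 1 + x \<bullet> xi 2 + x \<bullet> xi 3 = 0"
  unfolding inner_xi by simp

lemma inner_xi_xi:
  "xi 1 \<bullet> xi 1 = 12" "xi 2 \<bullet> xi 2 = 12" "xi 3 \<bullet> xi 3 = 12"
  "xi 1 \<bullet> xi 2 = - 6" "xi 1 \<bullet> xi 3 = - 6" "xi 2 \<bullet> xi 1 = - 6"
  "xi 2 \<bullet> xi 3 = - 6" "xi 3 \<bullet> xi 1 = - 6" "xi 3 \<bullet> xi 2 = - 6"
  unfolding inner_xi by (simp_all add: xi_simps)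

text \<open>The vectors \<open>xi i\<close> have squared length 12 and mutual products - 6, so a
  move along \<open>xi i\<close> changes each of the other two coordinates by half as much in the
  opposite direction.\<close>

lemma mirror_inner_xi:
  assumes "i \<in> {1,2,3}" "j \<in> {1,2,3}"
  shows "mirror k i x \<bullet> xi j =
    (if i = j then 2 * (- 2) ^ k - x \<bullet> xi i else x \<bullet> xi j + x \<bullet> xi i - (- 2) ^ k)"
  using assms by (auto simp: mirror_def inner_diff_left inner_xi_xi field_simps)

lemma plane_eqI:
  assumes "x \<bullet> xi 1 = y \<bullet> xi 1" "x \<bullet> xi 2 = y \<bullet> xi 2"
  shows "x = y"
  using assms unfolding inner_xi by (simp add: vec_eq_iff forall_2)

lemma T0_eq: "T0 = {x. \<forall>i\<in>{1,2,3}. x \<bullet> xi i \<le> 1}"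
proof (intro subset_antisym subsetI)
  fix x assume "x \<in> T0" then show "x \<in> {x. \<forall>i\<in>{1,2,3}. x \<bullet> xi i \<le> 1}"
    using T0_halfspaces by blast
next
  fix x assume x: "x \<in> {x. \<forall>i\<in>{1,2,3}. x \<bullet> xi i \<le> 1}"
  \<comment> \<open>Barycentric coordinates: \<open>?t i\<close> vanishes on the side
    \<open>x \<bullet> xi i = 1\<close> and equals 1 at the opposite vertex, where
    \<open>x \<bullet> xi i = - 2\<close>.\<close>
  let ?t = "\<lambda>i. (1 - x \<bullet> xi i) / 3"
  have "x = ?t 2 *\<^sub>R vector [- 1/2, - sqrt 3 / 6] + ?t 3 *\<^sub>R vector [1/2, - sqrt 3 / 6]
      + ?t 1 *\<^sub>R vector [0, sqrt 3 / 3]"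
    unfolding inner_xi by (simp add: vec_eq_iff forall_2 field_simps)
  moreover have "?t 2 + ?t 3 + ?t 1 = 1"
    using inner_xi_sum[of x] by (simp add: field_simps)
  moreover have "?t 2 \<ge> 0" "?t 3 \<ge> 0" "?t 1 \<ge> 0" using x by auto
  ultimately show "x \<in> T0" unfolding T0_def convex_hull_3 by blast
qed

text \<open>Division by the signed power in \<open>scaled\<close> gives one description for all
  \<open>k\<close>, although consecutive triangles point in opposite directions.\<close>

lemma tri_eq: "tri k = {x. \<forall>i\<in>{1,2,3}. scaled k i x \<le> 1}"
proof (intro subset_antisym subsetI)
  fix x assume "x \<in> tri k" then show "x \<in> {x. \<forall>i\<in>{1,2,3}. scaled k i x \<le> 1}"
    using tri_halfspaces unfolding scaled_def by blast
next
  fix x assume x: "x \<in> {x. \<forall>i\<in>{1,2,3}. scaled k i x \<le> 1}"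
  have "x = (- 2) ^ k *\<^sub>R ((1 / (- 2) ^ k) *\<^sub>R x)" by simp
  moreover have "(1 / (- 2) ^ k) *\<^sub>R x \<in> T0" using x unfolding T0_eq by (simp add: scaled_def)
  ultimately show "x \<in> tri k" unfolding tri_def by blast
qed

lemma inside_interior_tri:
  assumes "inside k x"
  shows "x \<in> interior (tri k)"
proof (rule interiorI[of "{x. inside k x}"])
  have "{x. inside k x} = (\<Inter>i\<in>{1,2,3}. {x. scaled k i x < 1})"
    by (auto simp: inside_def)
  moreover have "open {x. scaled k i x < 1}" for i
    unfolding scaled_def by (intro open_Collect_less continuous_intros) auto
  ultimately show "open {x. inside k x}" by (simp only: open_INT finite.intros ball_simps)
  show "{x. inside k x} \<subseteq> tri k" by (auto simp: inside_def tri_eq intro: less_imp_le)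
qed (use assms in simp)

lemma scaled_sum: "scaled k 1 x + scaled k 2 x + scaled k 3 x = 0"
  using inner_xi_sum[of x] unfolding scaled_def by (metis add_divide_distrib div_0)

lemma scaled_Suc: "scaled (Suc k) i x = - scaled k i x / 2"
  by (simp add: scaled_def)

lemma inside_iff: "inside k x \<longleftrightarrow> scaled k 1 x < 1 \<and> scaled k 2 x < 1 \<and> scaled k 3 x < 1"
  by (simp add: inside_def)

text \<open>Since the three coordinates add up to 0, these bounds allow at most one of them to reach
  1: a point lies in at most one corner, and a point on a fold line is not in a corner.\<close>

lemma inside_SucD:
  assumes "inside (Suc k) x"
  shows "scaled k 1 x > - 2" "scaled k 2 x > - 2" "scaled k 3 x > - 2"
  using assms unfolding inside_iff scaled_Suc by linarith+

lemma crease_inside: "inside k x \<Longrightarrow> crease S (Suc k) (x, up) = crease S k (x, up)"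
  by (rule crease_Suc) (simp add: inside_def scaled_def)

lemma crease_fold_line:
  assumes "inside (Suc k) x" "i \<in> {1,2,3}" "scaled k i x = 1"
  shows "crease S (Suc k) (x, up) = Some (if (S k = Up) = up then Red else Blue)"
proof -
  have "x \<in> tri k"
    using inside_SucD[OF assms(1)] scaled_sum[of k x] assms(2,3)
    unfolding tri_eq by auto
  then have "x \<in> midsegment k i"
    using assms(3) by (simp add: midsegment_def fold_line_def scaled_def)
  then have "fst (x, up) \<in> (\<Union>i\<in>{1,2,3}. midsegment k i)" using assms(2) by auto
  then show ?thesis by (simp only: crease.simps if_True snd_conv)
qed

text \<open>Only one corner contains the point, so the order of the tests in
  \<open>fold_layer\<close> is immaterial; the reflected point lands in the open
  \<open>tri k\<close>, ready for the next folding.\<close>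

lemma crease_corner:
  assumes "inside (Suc k) x" "i \<in> {1,2,3}" "scaled k i x > 1"
  shows "inside k (mirror k i x)"
    and "crease S (Suc k) (x, up) = crease S k (mirror k i x, \<not> up)"
proof -
  note b = inside_SucD[OF assms(1)] scaled_sum[of k x]
  have m: "scaled k j (mirror k i x) =
    (if i = j then 2 - scaled k i x
     else scaled k j x + scaled k i x - 1)" if "j \<in> {1,2,3}" for j
    unfolding scaled_def mirror_inner_xi[OF assms(2) that] by (simp add: diff_divide_distrib add_divide_distrib)
  show "inside k (mirror k i x)"
    unfolding inside_def using m assms(2,3) b by auto
  have "x \<notin> tri k" using assms(2,3) unfolding tri_eq by fastforce
  then have "x \<notin> (\<Union>i\<in>{1,2,3}. midsegment k i)" by (auto simp: midsegment_def)
  moreover have "x \<in> corner k j \<longleftrightarrow> j = i" if "j \<in> {1,2,3}" for j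
  proof -
    have "x \<in> tri (Suc k)" using assms(1) by (auto simp: inside_def tri_eq less_imp_le simp del: power_Suc)
    then have "x \<in> corner k j \<longleftrightarrow> scaled k j x > 1" by (simp add: corner_def scaled_def)
    then show ?thesis using that assms(2,3) b by auto
  qed
  then have "fold_layer k (x, up) = (mirror k i x, \<not> up)"
    using assms(2) by (auto simp: fold_layer_def)
  ultimately show "crease S (Suc k) (x, up) = crease S k (mirror k i x, \<not> up)"
    by simp
qed

lemma inside_Suc_cases:
  assumes "inside (Suc k) x"
  obtains "inside k x"
  | i where "i \<in> {1,2,3}" "scaled k i x = 1"
  | i where "i \<in> {1,2,3}" "scaled k i x > 1"
  unfolding inside_def by (meson linorder_neqE_linordered_idom)

section \<open>Grid coordinates of level \<open>m\<close> and foldings of stage at least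
  \<open>m\<close>\<close>

text \<open>
  The grid lines of level \<open>m\<close>, that is, the lines of \<open>(- 2) ^ m\<close> times the unit grid, are those
  where one of these coordinates is an integer.
\<close>

definition lcoord :: "nat \<Rightarrow> nat \<Rightarrow> plane \<Rightarrow> real" where
  "lcoord m i x = (scaled m i x - 1) / 3"

lemma lcoord_sum: "lcoord m 1 x + lcoord m 2 x + lcoord m 3 x = - 1"
  using scaled_sum[of m x] by (simp add: lcoord_def field_simps)

lemma inside_lcoord: "inside m x \<longleftrightarrow> lcoord m 1 x < 0 \<and> lcoord m 2 x < 0 \<and> lcoord m 3 x < 0"
  by (simp add: inside_iff lcoord_def)

text \<open>Because - 2 is congruent to 1 modulo 3, the fold lines of stage \<open>k\<close> are
  grid lines of every level \<open>m \<le> k\<close>, namely those of index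
  \<open>fold_index (k - m)\<close>.\<close>

lemma minus_two_power_mod_3: "\<exists>q::int. (- 2) ^ j = 3 * q + 1"
proof (induction j)
  case (Suc j)
  then obtain q :: int where "(- 2) ^ j = 3 * q + 1" by blast
  then have "(- 2) ^ Suc j = 3 * (- 2 * q - 1) + 1" by simp
  then show ?case by blast
qed auto

definition fold_index :: "nat \<Rightarrow> int" where
  "fold_index j = ((- 2) ^ j - 1) div 3"

lemma fold_index: "(- 2) ^ j = 3 * real_of_int (fold_index j) + 1"
proof -
  obtain q :: int where q: "(- 2) ^ j = 3 * q + 1" using minus_two_power_mod_3 by blast
  then have "fold_index j = q" by (simp add: fold_index_def)
  then show ?thesis using arg_cong[OF q, of real_of_int] by simp
qed

lemma scaled_eq_lcoord:
  assumes "m \<le> k"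
  shows "scaled k i x = (3 * lcoord m i x + 1) / (- 2) ^ (k - m)"
proof -
  have "(- 2 :: real) ^ k = (- 2) ^ m * (- 2) ^ (k - m)"
    using assms by (metis le_add_diff_inverse power_add)
  moreover have "3 * lcoord m i x + 1 = scaled m i x" by (simp add: lcoord_def field_simps)
  ultimately show ?thesis by (simp add: scaled_def)
qed

lemma mirror_lcoord:
  assumes "m \<le> k" "i \<in> {1,2,3}" "j \<in> {1,2,3}"
  shows "lcoord m j (mirror k i x) =
    (if i = j then 2 * fold_index (k - m) - lcoord m i x
     else lcoord m j x + lcoord m i x - fold_index (k - m))"
proof -
  have "(- 2 :: real) ^ k = (- 2) ^ m * (- 2) ^ (k - m)"
    using assms by (metis le_add_diff_inverse power_add)
  then have k: "(- 2 :: real) ^ k / (- 2) ^ m = 3 * real_of_int (fold_index (k - m)) + 1"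
    using fold_index[of "k - m"] by simp
  show ?thesis
    unfolding lcoord_def scaled_def mirror_inner_xi[OF assms(2,3)]
    using k by (simp add: diff_divide_distrib add_divide_distrib)
qed

lemma scaled_le_iff_lcoord:
  assumes "m \<le> k"
  shows "scaled k i x = 1 \<longleftrightarrow> lcoord m i x = fold_index (k - m)"
    and "scaled k i x > 1 \<longleftrightarrow>
      (if even (k - m) then lcoord m i x > fold_index (k - m) else lcoord m i x < fold_index (k - m))"
proof -
  let ?c = "(- 2 :: real) ^ (k - m)"
  have s: "if even (k - m) then ?c > 0 else ?c < 0"
    by (auto simp: zero_less_power_eq power_less_zero_eq)
  then show "scaled k i x = 1 \<longleftrightarrow> lcoord m i x = fold_index (k - m)"
    unfolding scaled_eq_lcoord[OF assms] using fold_index[of "k - m"] by (auto simp: field_simps)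
  show "scaled k i x > 1 \<longleftrightarrow>
      (if even (k - m) then lcoord m i x > fold_index (k - m) else lcoord m i x < fold_index (k - m))"
    unfolding scaled_eq_lcoord[OF assms] using fold_index[of "k - m"] s
    by (auto simp: less_divide_eq_1)
qed

text \<open>
  Equality of floors and ceilings says that \<open>x\<close> and \<open>y\<close> lie in the same open triangle, the same
  open edge, or are the same vertex of the grid of level \<open>m\<close>. Foldings of stage \<open>k \<ge> m\<close> respect
  this decomposition.
\<close>

definition same_cell :: "nat \<Rightarrow> plane \<Rightarrow> plane \<Rightarrow> bool" where
  "same_cell m x y \<longleftrightarrow> (\<forall>i\<in>{1,2,3}. \<lfloor>lcoord m i x\<rfloor> = \<lfloor>lcoord m i y\<rfloor> \<and> \<lceil>lcoord m i x\<rceil> = \<lceil>lcoord m i y\<rceil>)"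

lemma floor_ceiling_compare:
  fixes a b :: real and q :: int
  assumes "\<lfloor>a\<rfloor> = \<lfloor>b\<rfloor>" "\<lceil>a\<rceil> = \<lceil>b\<rceil>"
  shows "a = q \<longleftrightarrow> b = q" "a < q \<longleftrightarrow> b < q" "a > q \<longleftrightarrow> b > q"
  using assms by (metis ceiling_of_int floor_of_int floor_correct le_of_int_ceiling order_antisym,
    metis floor_less_iff, metis less_ceiling_iff)

lemma same_cell_scaled:
  assumes "same_cell m x y" "m \<le> k" "i \<in> {1,2,3}"
  shows "scaled k i x = 1 \<longleftrightarrow> scaled k i y = 1"
    and "scaled k i x > 1 \<longleftrightarrow> scaled k i y > 1"
proof -
  have "\<lfloor>lcoord m i x\<rfloor> = \<lfloor>lcoord m i y\<rfloor>" "\<lceil>lcoord m i x\<rceil> = \<lceil>lcoord m i y\<rceil>"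
    using assms(1,3) by (auto simp: same_cell_def)
  note c = floor_ceiling_compare[OF this, of "fold_index (k - m)"]
  show "scaled k i x = 1 \<longleftrightarrow> scaled k i y = 1"
    "scaled k i x > 1 \<longleftrightarrow> scaled k i y > 1"
    unfolding scaled_le_iff_lcoord[OF assms(2)] using c by auto
qed

text \<open>As the coordinates add up to - 1, the sum of two of them can be traded for the third. So
  a reflection turns each coordinate into an integer minus a single coordinate, a form that rounding
  respects.\<close>

lemma mirror_lcoord_third:
  assumes "m \<le> k" "i \<in> {1,2,3}" "j \<in> {1,2,3}" "l \<in> {1,2,3}" "i \<noteq> j" "l \<noteq> i" "l \<noteq> j"
  shows "lcoord m j (mirror k i x) = - lcoord m l x - of_int (fold_index (k - m) + 1)"
proof -
  have "lcoord m i x + lcoord m j x + lcoord m l x = - 1"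
    using lcoord_sum[of m x] assms(2-) by auto
  then show ?thesis using mirror_lcoord[OF assms(1-3), of x] assms(5) by simp
qed

lemma third_index:
  assumes "i \<in> {1,2,3::nat}" "j \<in> {1,2,3}" "i \<noteq> j"
  obtains l where "l \<in> {1,2,3}" "l \<noteq> i" "l \<noteq> j"
proof -
  have "{1,2,3} - {i,j} \<noteq> {}" using assms by auto
  then show thesis using that by blast
qed

text \<open>Negation exchanges floors and ceilings, which is why \<open>same_cell\<close> compares
  both.\<close>

lemma same_cell_mirror:
  assumes "same_cell m x y" "m \<le> k" "i \<in> {1,2,3}"
  shows "same_cell m (mirror k i x) (mirror k i y)"
  unfolding same_cell_def
proof
  fix j :: nat assume j: "j \<in> {1,2,3}"
  have fl: "\<lfloor>- a + of_int n\<rfloor> = - \<lceil>a\<rceil> + n" "\<lceil>- a + of_int n\<rceil> = - \<lfloor>a\<rfloor> + n" for a :: real and n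
    by (simp_all only: floor_add_int[symmetric] ceiling_add_of_int floor_minus ceiling_minus)
  have c: "\<lfloor>lcoord m i x\<rfloor> = \<lfloor>lcoord m i y\<rfloor>" "\<lceil>lcoord m i x\<rceil> = \<lceil>lcoord m i y\<rceil>" if "i \<in> {1,2,3}" for i
    using assms(1) that by (auto simp: same_cell_def)
  show "\<lfloor>lcoord m j (mirror k i x)\<rfloor> = \<lfloor>lcoord m j (mirror k i y)\<rfloor> \<and>
      \<lceil>lcoord m j (mirror k i x)\<rceil> = \<lceil>lcoord m j (mirror k i y)\<rceil>"
  proof (cases "i = j")
    case True
    have "lcoord m j (mirror k i x) = - lcoord m i x + of_int (2 * fold_index (k - m))" for x
      using mirror_lcoord[OF assms(2,3) j] True by simp
    then show ?thesis using c[OF assms(3)] by (simp only: fl)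
  next
    case False
    obtain l where l: "l \<in> {1,2,3}" "l \<noteq> i" "l \<noteq> j" using third_index[OF assms(3) j False] .
    have "lcoord m j (mirror k i x) = - lcoord m l x + of_int (- (fold_index (k - m) + 1))" for x
      using mirror_lcoord_third[OF assms(2,3) j l(1) False l(2,3)] by simp
    then show ?thesis using c[OF l(1)] by (simp only: fl)
  qed
qed

lemma mirror_on_line:
  assumes "lcoord m i x \<in> \<int>" "i \<in> {1,2,3}" "m \<le> k" "j \<in> {1,2,3}"
  shows "\<exists>l\<in>{1,2,3}. lcoord m l (mirror k j x) \<in> \<int>"
proof (cases "i = j")
  case True
  then show ?thesis using mirror_lcoord[OF assms(3,4,4)] assms by auto
next
  case False
  obtain l where l: "l \<in> {1,2,3}" "l \<noteq> j" "l \<noteq> i" using third_index[OF assms(4,2)] False by metis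
  then have "lcoord m l (mirror k j x) \<in> \<int>"
    using mirror_lcoord_third[OF assms(3,4) l(1) assms(2)] False assms(1) by force
  then show ?thesis using l by blast
qed

text \<open>Three negative numbers with sum - 1 all lie strictly between - 1 and 0.\<close>

lemma inside_not_on_line:
  assumes "inside m x" "i \<in> {1,2,3}"
  shows "lcoord m i x \<notin> \<int>"
proof
  assume "lcoord m i x \<in> \<int>"
  then obtain n where n: "lcoord m i x = of_int n" by (elim Ints_cases)
  have neg: "lcoord m 1 x < 0" "lcoord m 2 x < 0" "lcoord m 3 x < 0"
    using assms(1) unfolding inside_lcoord by auto
  then have "real_of_int n < 0" using n assms(2) by auto
  then have "real_of_int n \<le> - 1" by simp
  then show False using neg n lcoord_sum[of m x] assms(2) by auto
qed

text \<open>Points of one cell pass through all stages from \<open>m\<close> on side by side: both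
  inside, both on a fold line, or both in the same corner. They stay on grid lines of level
  \<open>m\<close>, none of which enters the open \<open>tri m\<close>, so a crease must occur
  before stage \<open>m\<close> is reached.\<close>

lemma crease_same_cell:
  assumes "m \<le> k" "inside k x" "inside k y" "same_cell m x y"
    and "i \<in> {1,2,3}" "lcoord m i x \<in> \<int>"
  shows "crease S k (x, up) = crease S k (y, up) \<and> crease S k (x, up) \<noteq> None"
  using assms
proof (induction k arbitrary: x y i up rule: dec_induct)
  case base
  then show ?case using inside_not_on_line by blast
next
  case (step k)
  from step.prems(1) show ?case
  proof (cases rule: inside_Suc_cases)
    case 1
    then have "inside k y"
      using same_cell_scaled[OF step.prems(3) step.hyps(1)] unfolding inside_def
      by (metis linorder_neqE_linordered_idom less_asym less_irrefl)
    with 1 show ?thesis using step.IH step.prems crease_inside by metis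
  next
    case (2 j)
    then show ?thesis
      using crease_fold_line step.prems same_cell_scaled[OF step.prems(3) step.hyps(1) 2(1)] by force
  next
    case (3 j)
    have "scaled k j y > 1"
      using 3 same_cell_scaled[OF step.prems(3) step.hyps(1) 3(1)] by blast
    note y = crease_corner[OF step.prems(2) 3(1) this]
    note x = crease_corner[OF step.prems(1) 3]
    obtain l where l: "l\<in>{1,2,3}" "lcoord m l (mirror k j x) \<in> \<int>"
      using mirror_on_line[OF step.prems(5,4) step.hyps(1) 3(1)] by blast
    show ?thesis
      using step.IH[OF x(1) y(1) same_cell_mirror[OF step.prems(3) step.hyps(1) 3(1)] l]
      unfolding x(2) y(2) .
  qed
qed

section \<open>Turning over and the creases of the last folding\<close>

text \<open>
  Off the lines of level 1 this is \<open>- 3\<close> on triangles oriented like \<^term>\<open>tri 1\<close> and \<open>- 2\<close> on the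
  others, so it records how often the layer has been turned over.
\<close>

definition floor_sum :: "plane \<Rightarrow> int" where
  "floor_sum x = \<lfloor>lcoord 1 1 x\<rfloor> + \<lfloor>lcoord 1 2 x\<rfloor> + \<lfloor>lcoord 1 3 x\<rfloor>"

lemma floor_sum_cases:
  assumes "\<forall>i\<in>{1,2,3}. lcoord 1 i x \<notin> \<int>"
  shows "floor_sum x = - 3 \<or> floor_sum x = - 2"
proof -
  have f: "of_int \<lfloor>lcoord 1 i x\<rfloor> < lcoord 1 i x" if "i \<in> {1,2,3}" for i
    using assms that by (metis Ints_of_int floor_correct order_le_less)
  have "real_of_int (floor_sum x) < - 1" "real_of_int (floor_sum x) > - 4"
    using f[of 1] f[of 2] f[of 3] lcoord_sum[of 1 x] unfolding floor_sum_def of_int_add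
    by (simp, linarith)
  then show ?thesis by linarith
qed

lemma floor_neg_shift: "x \<notin> \<int> \<Longrightarrow> \<lfloor>- x + of_int n\<rfloor> = - \<lfloor>x\<rfloor> - 1 + n" for x :: real
proof -
  assume "x \<notin> \<int>"
  then have "\<lceil>x\<rceil> = \<lfloor>x\<rfloor> + 1" by (metis Ints_of_int ceiling_altdef)
  then show ?thesis by (simp only: floor_add_int[symmetric] floor_minus)
qed

text \<open>Negating three non-integers costs 1 in each floor, the two exchanged coordinates cost 1
  more each, and the multiples of the fold index cancel; hence the 5. The values - 3 and - 2 are
  thereby swapped.\<close>

lemma floor_sum_mirror:
  assumes "\<forall>i\<in>{1,2,3}. lcoord 1 i x \<notin> \<int>" "1 \<le> k" "i \<in> {1,2,3}"
  shows "floor_sum (mirror k i x) = - floor_sum x - 5"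
    and "\<forall>j\<in>{1,2,3}. lcoord 1 j (mirror k i x) \<notin> \<int>"
proof -
  define q where "q = fold_index (k - 1)"
  have same: "lcoord 1 i (mirror k i x) = - lcoord 1 i x + of_int (2 * q)"
    using mirror_lcoord[OF assms(2,3,3)] by (simp add: q_def)
  have other: "lcoord 1 j (mirror k i x) = - lcoord 1 l x + of_int (- q - 1)"
    if "j \<in> {1,2,3}" "l \<in> {1,2,3}" "i \<noteq> j" "l \<noteq> i" "l \<noteq> j" for j l
    using mirror_lcoord_third[OF assms(2,3) that] by (simp add: q_def)
  obtain j l where jl: "{i,j,l} = {1,2,3}" "i \<noteq> j" "i \<noteq> l" "j \<noteq> l"
    and fs: "\<And>y. floor_sum y = \<lfloor>lcoord 1 i y\<rfloor> + \<lfloor>lcoord 1 j y\<rfloor> + \<lfloor>lcoord 1 l y\<rfloor>"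
  proof -
    consider "i = 1" | "i = 2" | "i = 3" using assms(3) by auto
    then show thesis
    proof cases
      case 1 then show ?thesis by (intro that[of 2 3]) (auto simp: floor_sum_def)
    next
      case 2 then show ?thesis by (intro that[of 1 3]) (auto simp: floor_sum_def)
    next
      case 3 then show ?thesis by (intro that[of 1 2]) (auto simp: floor_sum_def)
    qed
  qed
  then have m: "j \<in> {1,2,3}" "l \<in> {1,2,3}" by blast+
  have n: "lcoord 1 i x \<notin> \<int>" "lcoord 1 j x \<notin> \<int>" "lcoord 1 l x \<notin> \<int>"
    using assms(1,3) m by blast+
  note eqs = same other[OF m jl(2) jl(3)[symmetric] jl(4)[symmetric]]
    other[OF m(2,1) jl(3) jl(2)[symmetric] jl(4)]
  show "floor_sum (mirror k i x) = - floor_sum x - 5"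
    unfolding fs eqs floor_neg_shift[OF n(1)] floor_neg_shift[OF n(2)] floor_neg_shift[OF n(3)]
    by simp
  have "- r + of_int s \<notin> \<int>" if "r \<notin> \<int>" for r :: real and s
    using that by (metis Ints_of_int Ints_diff add_diff_cancel_right' minus_in_Ints_iff)
  then have "lcoord 1 i (mirror k i x) \<notin> \<int>" "lcoord 1 j (mirror k i x) \<notin> \<int>"
    "lcoord 1 l (mirror k i x) \<notin> \<int>"
    unfolding eqs using n by blast+
  then show "\<forall>j\<in>{1,2,3}. lcoord 1 j (mirror k i x) \<notin> \<int>"
    using jl(1) by (metis empty_iff insert_iff)
qed

lemma mirror_on_line_0:
  assumes "lcoord 0 i x \<in> \<int>" "i \<in> {1,2,3}" "j \<in> {1,2,3}"
  shows "\<exists>l\<in>{1,2,3}. lcoord 0 l (mirror k j x) \<in> \<int>"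
  using mirror_on_line[OF assms(1,2) _ assms(3), of k] by simp

text \<open>Off the lines of level 1 the stages \<open>k \<ge> 1\<close> never crease the point,
  they only reflect it. Each reflection flips both \<open>up\<close> and the truth of
  \<open>floor_sum x = - 3\<close>, so their equality is an invariant and can be evaluated before
  any folding.\<close>

lemma crease_level_0:
  assumes "1 \<le> k" "inside k x" "\<forall>i\<in>{1,2,3}. lcoord 1 i x \<notin> \<int>"
    and "i \<in> {1,2,3}" "lcoord 0 i x \<in> \<int>"
  shows "crease S k (x, up) =
    Some (if (S 0 = Up) = (up = (floor_sum x = - 3)) then Red else Blue)"
  using assms
proof (induction k arbitrary: x i up rule: dec_induct)
  case base
  have "lcoord 1 1 x < 0" "lcoord 1 2 x < 0" "lcoord 1 3 x < 0"
    using base.prems(1) unfolding inside_lcoord by auto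
  then have "\<lfloor>lcoord 1 1 x\<rfloor> = - 1" "\<lfloor>lcoord 1 2 x\<rfloor> = - 1" "\<lfloor>lcoord 1 3 x\<rfloor> = - 1"
    using lcoord_sum[of 1 x] by linarith+
  then have fs: "floor_sum x = - 3" by (simp add: floor_sum_def)
  \<comment> \<open>With both points equal to \<open>x\<close>, the lemma yields just the existence
    of a crease; with one stage left, it has to come from \<open>S 0\<close>.\<close>
  have "crease S 1 (x, up) \<noteq> None"
    using crease_same_cell[of 0 1 x x i S up] base.prems by (simp add: same_cell_def)
  then show ?case using fs unfolding One_nat_def by (auto split: if_splits)
next
  case (step k)
  from step.prems(1) show ?case
  proof (cases rule: inside_Suc_cases)
    case 1
    then show ?thesis using step.IH step.prems crease_inside by metis
  next
    case (2 j)
    then show ?thesis using step.prems(2) scaled_le_iff_lcoord(1)[OF step.hyps(1)] by auto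
  next
    case (3 j)
    note x = crease_corner[OF step.prems(1) 3]
    note f = floor_sum_mirror[OF step.prems(2) step.hyps(1) 3(1)]
    obtain l where l: "l\<in>{1,2,3}" "lcoord 0 l (mirror k j x) \<in> \<int>"
      using mirror_on_line_0[OF step.prems(4,3) 3(1)] by blast
    have "(floor_sum (mirror k j x) = - 3) = (floor_sum x \<noteq> - 3)"
      using floor_sum_cases[OF step.prems(2)] f(1) by auto
    then show ?thesis
      unfolding x(2) step.IH[OF x(1) f(2) l] by auto
  qed
qed

subsection \<open>Edges of the grid\<close>

lemma inside_bounded:
  assumes "bounded A"
  shows "\<exists>k\<ge>1. \<forall>x\<in>A. inside k x"
proof -
  obtain M where M: "\<And>x. x \<in> A \<Longrightarrow> norm x \<le> M" using assms by (auto simp: bounded_iff)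
  define N where "N = M * (norm (xi 1) + norm (xi 2) + norm (xi 3))"
  obtain n where n: "N < 2 ^ n" using real_arch_pow[of 2 N] by auto
  have "inside (Suc n) x" if "x \<in> A" for x
    unfolding inside_def
  proof
    fix i :: nat assume i: "i \<in> {1,2,3}"
    have "\<bar>x \<bullet> xi i\<bar> \<le> norm x * norm (xi i)" by (rule Cauchy_Schwarz_ineq2)
    also have "\<dots> \<le> M * (norm (xi 1) + norm (xi 2) + norm (xi 3))"
      using i M[OF that] norm_ge_zero[of x] by (intro mult_mono) (auto intro: order_trans[OF norm_ge_zero])
    also have "\<dots> < 2 ^ n" using n by (simp add: N_def)
    finally have "\<bar>scaled (Suc n) i x\<bar> < 1"
      by (simp add: scaled_def abs_divide power_abs abs_mult)
    then show "scaled (Suc n) i x < 1" by simp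
  qed
  then show ?thesis by (intro exI[of _ "Suc n"]) auto
qed

lemma folding_pattern_eqI:
  assumes "rel_interior e \<noteq> {}"
    and "\<And>x. x \<in> rel_interior e \<Longrightarrow> inside k x \<and> crease S k (x, True) = Some c"
  shows "folding_pattern S e = c"
  unfolding folding_pattern_def
proof (rule the_equality)
  have k: "rel_interior e \<subseteq> interior (tri k)" using assms(2) inside_interior_tri by blast
  show "\<exists>k. rel_interior e \<subseteq> interior (tri k) \<and> finite_pattern S k e c"
    using k assms(2) by (auto simp: finite_pattern_def)
  fix c' assume "\<exists>k. rel_interior e \<subseteq> interior (tri k) \<and> finite_pattern S k e c'"
  then have "finite_pattern S k e c'" using finite_pattern_indep k by blast
  then show "c' = c" using assms by (force simp: finite_pattern_def)
qed

text \<open>Comparing every point of one edge with every point of the other shows at once that each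
  edge has a single color and that the two colors agree.\<close>

lemma folding_pattern_same_cell:
  assumes "bounded e" "bounded e'" "rel_interior e \<noteq> {}" "rel_interior e' \<noteq> {}"
    and cell: "\<And>x y. x \<in> rel_interior e \<Longrightarrow> y \<in> rel_interior e' \<Longrightarrow>
      same_cell 1 x y \<and> lcoord 1 i x \<in> \<int>"
    and i: "i \<in> {1,2,3}"
  shows "folding_pattern S e = folding_pattern S e'"
proof -
  obtain k where k: "1 \<le> k" "\<And>x. x \<in> e \<union> e' \<Longrightarrow> inside k x"
    using inside_bounded[of "e \<union> e'"] assms(1,2) by auto
  have in_e: "inside k x" if "x \<in> rel_interior e \<union> rel_interior e'" for x
    using that rel_interior_subset k(2) by blast
  obtain x0 y0 where x0: "x0 \<in> rel_interior e" and y0: "y0 \<in> rel_interior e'"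
    using assms(3,4) by blast
  have eq: "crease S k (x, True) = crease S k (y, True) \<and> crease S k (x, True) \<noteq> None"
    if "x \<in> rel_interior e" "y \<in> rel_interior e'" for x y
    using crease_same_cell[OF k(1), of x y i S True] cell[OF that] i in_e that by blast
  obtain c where c: "crease S k (x0, True) = Some c" using eq[OF x0 y0] by blast
  have "folding_pattern S e = c"
    by (rule folding_pattern_eqI[OF assms(3)]) (use eq c in_e x0 y0 in fastforce)
  moreover have "folding_pattern S e' = c"
    by (rule folding_pattern_eqI[OF assms(4)]) (use eq c in_e x0 y0 in fastforce)
  ultimately show ?thesis by simp
qed

text \<open>The integers \<open>n1\<close>, \<open>n2\<close>, \<open>n3\<close> name the open
  triangle of side 2 that contains the open edge; their sum is its orientation.\<close>

lemma folding_pattern_level_0: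
  assumes "bounded e" "rel_interior e \<noteq> {}" "i \<in> {1,2,3}"
    and cell: "\<And>x. x \<in> rel_interior e \<Longrightarrow> lcoord 0 i x \<in> \<int>
      \<and> of_int n1 < lcoord 1 1 x \<and> lcoord 1 1 x < of_int n1 + 1
      \<and> of_int n2 < lcoord 1 2 x \<and> lcoord 1 2 x < of_int n2 + 1
      \<and> of_int n3 < lcoord 1 3 x \<and> lcoord 1 3 x < of_int n3 + 1"
  shows "folding_pattern S e =
    (if (S 0 = Up) = (n1 + n2 + n3 = - 3) then Red else Blue)"
proof -
  obtain k where k: "1 \<le> k" "\<And>x. x \<in> e \<Longrightarrow> inside k x"
    using inside_bounded[of "e"] assms(1) by auto
  have fl: "\<lfloor>z\<rfloor> = n \<and> z \<notin> \<int>" if "of_int n < z" "z < of_int n + 1" for z :: real and n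
  proof -
    have "\<lfloor>z\<rfloor> = n" using that by linarith
    then show ?thesis using that by (metis Ints_cases floor_of_int less_irrefl)
  qed
  show ?thesis
  proof (rule folding_pattern_eqI[OF assms(2), of k])
    fix x assume x: "x \<in> rel_interior e"
    have in_k: "inside k x" using x rel_interior_subset k(2) by blast
    have f: "\<lfloor>lcoord 1 1 x\<rfloor> = n1 \<and> lcoord 1 1 x \<notin> \<int>" "\<lfloor>lcoord 1 2 x\<rfloor> = n2 \<and> lcoord 1 2 x \<notin> \<int>"
      "\<lfloor>lcoord 1 3 x\<rfloor> = n3 \<and> lcoord 1 3 x \<notin> \<int>"
      using fl cell[OF x] by blast+
    then have "\<forall>i\<in>{1,2,3}. lcoord 1 i x \<notin> \<int>" by auto
    then have "crease S k (x, True) =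
        Some (if (S 0 = Up) = (True = (floor_sum x = - 3)) then Red else Blue)"
      using crease_level_0[OF k(1) in_k _ assms(3)] cell[OF x] by blast
    then show "inside k x \<and> crease S k (x, True) =
        Some (if (S 0 = Up) = (n1 + n2 + n3 = - 3) then Red else Blue)"
      using in_k f by (simp add: floor_sum_def)
  qed
qed

section \<open>Integer indices and the parity rules for edge colors\<close>

text \<open>
  The third coordinate of \<open>vtx a b\<close> has index \<open>- a - b - 1\<close>; the vertex lies on the coarse line of a
  direction iff the index for that direction is odd.
\<close>

definition vtx :: "int \<Rightarrow> int \<Rightarrow> plane" where
  "vtx a b = vector [(2 * of_int b + of_int a + 1) / 2, - (3 * of_int a + 1) * sqrt 3 / 6]"

lemma vtx_inner_xi:
  "vtx a b \<bullet> xi 1 = 3 * of_int a + 1"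
  "vtx a b \<bullet> xi 2 = 3 * of_int b + 1"
  "vtx a b \<bullet> xi 3 = - 3 * of_int a - 3 * of_int b - 2"
  unfolding inner_xi by (simp_all add: vtx_def field_simps)

lemma vtx_eq_iff [simp]: "vtx a b = vtx c d \<longleftrightarrow> a = c \<and> b = d"
proof
  assume "vtx a b = vtx c d"
  then have "vtx a b \<bullet> xi 1 = vtx c d \<bullet> xi 1" "vtx a b \<bullet> xi 2 = vtx c d \<bullet> xi 2" by simp_all
  then show "a = c \<and> b = d" unfolding vtx_inner_xi by simp
qed simp

lemma eq_vtxI:
  assumes "p \<bullet> xi 1 = 3 * of_int a + 1" "p \<bullet> xi 2 = 3 * of_int b + 1"
  shows "p = vtx a b"
  by (rule plane_eqI) (simp_all add: assms vtx_inner_xi)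

text \<open>Junk value: every index \<open>i\<close> other than 1 and 2 is treated as 3.\<close>

definition edge :: "nat \<Rightarrow> int \<Rightarrow> int \<Rightarrow> plane set" where
  "edge i a b = closed_segment (vtx a b)
     (if i = 1 then vtx a (b - 1) else if i = 2 then vtx (a - 1) b else vtx (a - 1) (b + 1))"

lemma bounded_edge: "bounded (edge i a b)"
  unfolding edge_def by (intro bounded_closed_segment)

lemma rel_interior_edge_ne: "rel_interior (edge i a b) \<noteq> {}"
  by (simp add: rel_interior_eq_empty edge_def)

lemma rel_interior_edge:
  assumes "x \<in> rel_interior (edge i a b)"
  obtains t :: real where "0 < t" "t < 1"
    "x \<bullet> xi 1 = 3 * of_int a + 1 - (if i = 1 then 0 else 3 * t)"
    "x \<bullet> xi 2 = 3 * of_int b + 1 - (if i = 1 then 3 * t else if i = 2 then 0 else - 3 * t)"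
    "x \<bullet> xi 3 = - 3 * of_int a - 3 * of_int b - 2 + (if i = 1 \<or> i = 2 then 3 * t else 0)"
proof -
  define q where "q = (if i = 1 then vtx a (b - 1) else if i = 2 then vtx (a - 1) b else vtx (a - 1) (b + 1))"
  have "vtx a b \<noteq> q" by (simp add: q_def)
  then have "x \<in> open_segment (vtx a b) q"
    using assms by (simp add: edge_def q_def[symmetric] rel_interior_closed_segment)
  then obtain t where t: "0 < t" "t < 1" "x = (1 - t) *\<^sub>R vtx a b + t *\<^sub>R q"
    by (auto simp: in_segment)
  show thesis
    by (rule that[OF t(1,2)])
      (auto simp: t(3) q_def inner_add_left vtx_inner_xi algebra_simps)
qed

lemma lcoord_0: "lcoord 0 i x = (x \<bullet> xi i - 1) / 3"
  by (simp add: lcoord_def scaled_def)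

text \<open>Equivalently \<open>lcoord 1 i x = - (lcoord 0 i x + 1) / 2\<close>, so the coarse lines
  are exactly the grid lines of odd index.\<close>

lemma lcoord_1: "lcoord 1 i x = - (x \<bullet> xi i + 2) / 6"
  by (simp add: lcoord_def scaled_def field_simps)

text \<open>A line of even index is not coarse, so the edge is a middle edge of a triangle of side
  2. The three summands below are the floors of its level 1 coordinates, and the parity of
  \<open>b\<close> shifts the last one, that is, it decides the orientation.\<close>

lemma edge_1_mid_color:
  assumes "even a"
  shows "folding_pattern S (edge 1 a b) = (if (S 0 = Up) = even b then Red else Blue)"
proof -
  obtain p where "a = 2 * p" using assms by (elim evenE)
  then have p: "real_of_int a = 2 * real_of_int p" by simp
  define q where "q = b div 2"
  have q: "real_of_int b = 2 * real_of_int q + (if even b then 0 else 1)"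
    by (auto simp: q_def real_of_int_div elim!: oddE)
  have "folding_pattern S (edge 1 a b) =
    (if (S 0 = Up) = ((- p - 1) + (- q - 1) + (if even b then p + q - 1 else p + q) = - 3)
      then Red else Blue)"
  proof (rule folding_pattern_level_0[OF bounded_edge rel_interior_edge_ne, of 1])
    fix x assume "x \<in> rel_interior (edge 1 a b)"
    then obtain t where t: "0 < t" "t < 1" "x \<bullet> xi 1 = 3 * of_int a + 1"
      "x \<bullet> xi 2 = 3 * of_int b + 1 - 3 * t" "x \<bullet> xi 3 = - 3 * of_int a - 3 * of_int b - 2 + 3 * t"
      by (auto elim!: rel_interior_edge)
    have "lcoord 0 1 x = of_int a" unfolding lcoord_0 t(3) by simp
    then have "lcoord 0 1 x \<in> \<int>" by (simp only: Ints_of_int)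
    then show "lcoord 0 1 x \<in> \<int>
      \<and> of_int (- p - 1) < lcoord 1 1 x \<and> lcoord 1 1 x < of_int (- p - 1) + 1
      \<and> of_int (- q - 1) < lcoord 1 2 x \<and> lcoord 1 2 x < of_int (- q - 1) + 1
      \<and> of_int (if even b then p + q - 1 else p + q) < lcoord 1 3 x
      \<and> lcoord 1 3 x < of_int (if even b then p + q - 1 else p + q) + 1"
      unfolding lcoord_1 t(3-) using t(1,2) p q by (cases "even b"; simp only: if_True if_False simp_thms of_int_diff of_int_add of_int_minus of_int_1 of_int_numeral; intro conjI; argo)
  qed simp
  moreover have "((- p - 1) + (- q - 1) + (if even b then p + q - 1 else p + q) = - 3) = even b" by simp
  ultimately show ?thesis by (simp only:)
qed

lemma edge_2_mid_color:
  assumes "even b"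
  shows "folding_pattern S (edge 2 a b) = (if (S 0 = Up) = even a then Red else Blue)"
proof -
  obtain q where "b = 2 * q" using assms by (elim evenE)
  then have q: "real_of_int b = 2 * real_of_int q" by simp
  define p where "p = a div 2"
  have p: "real_of_int a = 2 * real_of_int p + (if even a then 0 else 1)"
    by (auto simp: p_def real_of_int_div elim!: oddE)
  have "folding_pattern S (edge 2 a b) =
    (if (S 0 = Up) = ((- p - 1) + (- q - 1) + (if even a then p + q - 1 else p + q) = - 3)
      then Red else Blue)"
  proof (rule folding_pattern_level_0[OF bounded_edge rel_interior_edge_ne, of 2])
    fix x assume "x \<in> rel_interior (edge 2 a b)"
    then obtain t where t: "0 < t" "t < 1" "x \<bullet> xi 1 = 3 * of_int a + 1 - 3 * t"
      "x \<bullet> xi 2 = 3 * of_int b + 1" "x \<bullet> xi 3 = - 3 * of_int a - 3 * of_int b - 2 + 3 * t"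
      by (auto elim!: rel_interior_edge)
    have "lcoord 0 2 x = of_int b" unfolding lcoord_0 t(4) by simp
    then have "lcoord 0 2 x \<in> \<int>" by (simp only: Ints_of_int)
    then show "lcoord 0 2 x \<in> \<int>
      \<and> of_int (- p - 1) < lcoord 1 1 x \<and> lcoord 1 1 x < of_int (- p - 1) + 1
      \<and> of_int (- q - 1) < lcoord 1 2 x \<and> lcoord 1 2 x < of_int (- q - 1) + 1
      \<and> of_int (if even a then p + q - 1 else p + q) < lcoord 1 3 x
      \<and> lcoord 1 3 x < of_int (if even a then p + q - 1 else p + q) + 1"
      unfolding lcoord_1 t(3-) using t(1,2) p q by (cases "even a"; simp only: if_True if_False simp_thms of_int_diff of_int_add of_int_minus of_int_1 of_int_numeral; intro conjI; argo)
  qed simp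
  moreover have "((- p - 1) + (- q - 1) + (if even a then p + q - 1 else p + q) = - 3) = even a" by simp
  ultimately show ?thesis by (simp only:)
qed

text \<open>The third index is \<open>- a - b - 1\<close>, so this is again the case of a line of
  even index.\<close>

lemma edge_3_mid_color:
  assumes "odd (a + b)"
  shows "folding_pattern S (edge 3 a b) = (if (S 0 = Up) = even a then Red else Blue)"
proof -
  define p where "p = a div 2"
  define q where "q = b div 2"
  have p: "real_of_int a = 2 * real_of_int p + (if even a then 0 else 1)"
    by (auto simp: p_def real_of_int_div elim!: oddE)
  have q: "real_of_int b = 2 * real_of_int q + (if even a then 1 else 0)"
    using assms by (auto simp: q_def real_of_int_div elim!: oddE)
  have "folding_pattern S (edge 3 a b) =
    (if (S 0 = Up) = ((- p - 1) + (if even a then - q - 2 else - q - 1) + (p + q) = - 3)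
      then Red else Blue)"
  proof (rule folding_pattern_level_0[OF bounded_edge rel_interior_edge_ne, of 3])
    fix x assume "x \<in> rel_interior (edge 3 a b)"
    then obtain t where t: "0 < t" "t < 1" "x \<bullet> xi 1 = 3 * of_int a + 1 - 3 * t"
      "x \<bullet> xi 2 = 3 * of_int b + 1 + 3 * t" "x \<bullet> xi 3 = - 3 * of_int a - 3 * of_int b - 2"
      by (auto elim!: rel_interior_edge)
    have "lcoord 0 3 x = of_int (- a - b - 1)" unfolding lcoord_0 t(5) by simp
    then have "lcoord 0 3 x \<in> \<int>" by (simp only: Ints_of_int)
    then show "lcoord 0 3 x \<in> \<int>
      \<and> of_int (- p - 1) < lcoord 1 1 x \<and> lcoord 1 1 x < of_int (- p - 1) + 1
      \<and> of_int (if even a then - q - 2 else - q - 1) < lcoord 1 2 x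
      \<and> lcoord 1 2 x < of_int (if even a then - q - 2 else - q - 1) + 1
      \<and> of_int (p + q) < lcoord 1 3 x \<and> lcoord 1 3 x < of_int (p + q) + 1"
      unfolding lcoord_1 t(3-) using t(1,2) p q by (cases "even a"; simp only: if_True if_False simp_thms of_int_diff of_int_add of_int_minus of_int_1 of_int_numeral; intro conjI; argo)
  qed simp
  moreover have "((- p - 1) + (if even a then - q - 2 else - q - 1) + (p + q) = - 3) = even a" by simp
  ultimately show ?thesis by (simp only:)
qed

lemma same_cellI:
  assumes "\<And>i. i \<in> {1,2,3} \<Longrightarrow> lcoord m i x = lcoord m i y \<or>
    (\<exists>n. of_int n < lcoord m i x \<and> lcoord m i x < of_int n + 1 \<and>
         of_int n < lcoord m i y \<and> lcoord m i y < of_int n + 1)"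
  shows "same_cell m x y"
proof -
  have "\<lfloor>z\<rfloor> = n \<and> \<lceil>z\<rceil> = n + 1" if "of_int n < z" "z < of_int n + 1" for z :: real and n
    using that by (auto simp: floor_eq_iff ceiling_eq_iff)
  then show ?thesis unfolding same_cell_def using assms by metis
qed

text \<open>Odd \<open>a\<close> makes the line coarse and even \<open>b\<close> makes the common
  vertex the midpoint of a coarse edge. For odd \<open>b\<close> the two edges would meet at a
  coarse vertex, where the color may change.\<close>

lemma edge_1_half_color:
  assumes "odd a" "even b"
  shows "folding_pattern S (edge 1 a (b + 1)) = folding_pattern S (edge 1 a b)"
proof -
  obtain p q where pq: "a = 2 * p + 1" "b = 2 * q" using assms by (elim evenE oddE)
  show ?thesis
  proof (rule folding_pattern_same_cell[of _ _ 1])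
    fix x y assume "x \<in> rel_interior (edge 1 a (b + 1))" "y \<in> rel_interior (edge 1 a b)"
    then obtain t s where t: "0 < t" "t < 1" "0 < s" "s < 1"
      "x \<bullet> xi 1 = 3 * of_int a + 1"
      "x \<bullet> xi 2 = 3 * of_int b + 4 - 3 * t" "x \<bullet> xi 3 = - 3 * of_int a - 3 * of_int b - 5 + 3 * t"
      "y \<bullet> xi 1 = 3 * of_int a + 1"
      "y \<bullet> xi 2 = 3 * of_int b + 1 - 3 * s" "y \<bullet> xi 3 = - 3 * of_int a - 3 * of_int b - 2 + 3 * s"
      by (auto elim!: rel_interior_edge)
    have "lcoord 1 1 x = of_int (- p - 1)" unfolding lcoord_1 t(5) pq by simp
    then have "lcoord 1 1 x \<in> \<int>" by (simp only: Ints_of_int)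
    moreover have "same_cell 1 x y"
    proof (rule same_cellI)
      have "of_int (- q - 1) < lcoord 1 2 x \<and> lcoord 1 2 x < of_int (- q - 1) + 1 \<and>
         of_int (- q - 1) < lcoord 1 2 y \<and> lcoord 1 2 y < of_int (- q - 1) + 1"
        "of_int (p + q) < lcoord 1 3 x \<and> lcoord 1 3 x < of_int (p + q) + 1 \<and>
         of_int (p + q) < lcoord 1 3 y \<and> lcoord 1 3 y < of_int (p + q) + 1"
        "lcoord 1 1 x = lcoord 1 1 y"
        unfolding lcoord_1 t(5-) using t(1-4) pq by auto
      then show "lcoord 1 i x = lcoord 1 i y \<or>
         (\<exists>n. of_int n < lcoord 1 i x \<and> lcoord 1 i x < of_int n + 1 \<and>
         of_int n < lcoord 1 i y \<and> lcoord 1 i y < of_int n + 1)" if "i \<in> {1,2,3}" for i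
        using that by blast
    qed
    ultimately show "same_cell 1 x y \<and> lcoord 1 1 x \<in> \<int>" by blast
  qed (simp_all add: bounded_edge rel_interior_edge_ne)
qed

lemma edge_2_half_color:
  assumes "even a" "odd b"
  shows "folding_pattern S (edge 2 (a + 1) b) = folding_pattern S (edge 2 a b)"
proof -
  obtain p q where pq: "a = 2 * p" "b = 2 * q + 1" using assms by (elim evenE oddE)
  show ?thesis
  proof (rule folding_pattern_same_cell[of _ _ 2])
    fix x y assume "x \<in> rel_interior (edge 2 (a + 1) b)" "y \<in> rel_interior (edge 2 a b)"
    then obtain t s where t: "0 < t" "t < 1" "0 < s" "s < 1"
      "x \<bullet> xi 2 = 3 * of_int b + 1"
      "x \<bullet> xi 1 = 3 * of_int a + 4 - 3 * t" "x \<bullet> xi 3 = - 3 * of_int a - 3 * of_int b - 5 + 3 * t"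
      "y \<bullet> xi 2 = 3 * of_int b + 1"
      "y \<bullet> xi 1 = 3 * of_int a + 1 - 3 * s" "y \<bullet> xi 3 = - 3 * of_int a - 3 * of_int b - 2 + 3 * s"
      by (auto elim!: rel_interior_edge)
    have "lcoord 1 2 x = of_int (- q - 1)" unfolding lcoord_1 t(5) pq by simp
    then have "lcoord 1 2 x \<in> \<int>" by (simp only: Ints_of_int)
    moreover have "same_cell 1 x y"
    proof (rule same_cellI)
      have "of_int (- p - 1) < lcoord 1 1 x \<and> lcoord 1 1 x < of_int (- p - 1) + 1 \<and>
         of_int (- p - 1) < lcoord 1 1 y \<and> lcoord 1 1 y < of_int (- p - 1) + 1"
        "of_int (p + q) < lcoord 1 3 x \<and> lcoord 1 3 x < of_int (p + q) + 1 \<and>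
         of_int (p + q) < lcoord 1 3 y \<and> lcoord 1 3 y < of_int (p + q) + 1"
        "lcoord 1 2 x = lcoord 1 2 y"
        unfolding lcoord_1 t(5-) using t(1-4) pq by auto
      then show "lcoord 1 i x = lcoord 1 i y \<or>
         (\<exists>n. of_int n < lcoord 1 i x \<and> lcoord 1 i x < of_int n + 1 \<and>
         of_int n < lcoord 1 i y \<and> lcoord 1 i y < of_int n + 1)" if "i \<in> {1,2,3}" for i
        using that by blast
    qed
    ultimately show "same_cell 1 x y \<and> lcoord 1 2 x \<in> \<int>" by blast
  qed (simp_all add: bounded_edge rel_interior_edge_ne)
qed

text \<open>For even \<open>a\<close> and \<open>b\<close> the third index is odd, and
  \<open>vtx a b\<close> is the midpoint of a coarse edge.\<close>

lemma edge_3_half_color: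
  assumes "even a" "even b"
  shows "folding_pattern S (edge 3 (a + 1) (b - 1)) = folding_pattern S (edge 3 a b)"
proof -
  obtain p q where pq: "a = 2 * p" "b = 2 * q" using assms by (elim evenE)
  show ?thesis
  proof (rule folding_pattern_same_cell[of _ _ 3])
    fix x y assume "x \<in> rel_interior (edge 3 (a + 1) (b - 1))" "y \<in> rel_interior (edge 3 a b)"
    then obtain t s where t: "0 < t" "t < 1" "0 < s" "s < 1"
      "x \<bullet> xi 3 = - 3 * of_int a - 3 * of_int b - 2"
      "x \<bullet> xi 1 = 3 * of_int a + 4 - 3 * t" "x \<bullet> xi 2 = 3 * of_int b - 2 + 3 * t"
      "y \<bullet> xi 3 = - 3 * of_int a - 3 * of_int b - 2"
      "y \<bullet> xi 1 = 3 * of_int a + 1 - 3 * s" "y \<bullet> xi 2 = 3 * of_int b + 1 + 3 * s"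
      by (auto elim!: rel_interior_edge)
    have "lcoord 1 3 x = of_int (p + q)" unfolding lcoord_1 t(5) pq by simp
    then have "lcoord 1 3 x \<in> \<int>" by (simp only: Ints_of_int)
    moreover have "same_cell 1 x y"
    proof (rule same_cellI)
      have "of_int (- p - 1) < lcoord 1 1 x \<and> lcoord 1 1 x < of_int (- p - 1) + 1 \<and>
         of_int (- p - 1) < lcoord 1 1 y \<and> lcoord 1 1 y < of_int (- p - 1) + 1"
        "of_int (- q - 1) < lcoord 1 2 x \<and> lcoord 1 2 x < of_int (- q - 1) + 1 \<and>
         of_int (- q - 1) < lcoord 1 2 y \<and> lcoord 1 2 y < of_int (- q - 1) + 1"
        "lcoord 1 3 x = lcoord 1 3 y"
        unfolding lcoord_1 t(5-) using t(1-4) pq by auto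
      then show "lcoord 1 i x = lcoord 1 i y \<or>
         (\<exists>n. of_int n < lcoord 1 i x \<and> lcoord 1 i x < of_int n + 1 \<and>
         of_int n < lcoord 1 i y \<and> lcoord 1 i y < of_int n + 1)" if "i \<in> {1,2,3}" for i
        using that by blast
    qed
    ultimately show "same_cell 1 x y \<and> lcoord 1 3 x \<in> \<int>" by blast
  qed (simp_all add: bounded_edge rel_interior_edge_ne)
qed

subsection \<open>Unit triangles\<close>

text \<open>The quadratic form is the norm form of the triangular lattice, so questions about unit
  distances become integer equations.\<close>

lemma dist_vtx:
  "(dist (vtx a b) (vtx c d))\<^sup>2 = of_int ((a - c)\<^sup>2 + (a - c) * (b - d) + (b - d)\<^sup>2)"
proof -
  have "(dist (vtx a b) (vtx c d))\<^sup>2 = (norm (vtx a b - vtx c d))\<^sup>2"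
    by (simp add: dist_norm)
  also have "\<dots> = ((vtx a b - vtx c d) $ 1)\<^sup>2 + ((vtx a b - vtx c d) $ 2)\<^sup>2"
    unfolding power2_norm_eq_inner by (simp add: inner_vec_def sum_2 power2_eq_square)
  also have "(vtx a b - vtx c d) $ 1 = (2 * (of_int b - of_int d) + (of_int a - of_int c)) / 2"
    by (simp add: vtx_def field_simps)
  also have "(vtx a b - vtx c d) $ 2 = - (of_int a - of_int c) * sqrt 3 / 2"
    by (simp add: vtx_def field_simps)
  also have "((2 * (of_int b - of_int d) + (of_int a - of_int c)) / 2)\<^sup>2
      + (- (of_int a - of_int c) * sqrt 3 / 2)\<^sup>2
      = (of_int ((a - c)\<^sup>2 + (a - c) * (b - d) + (b - d)\<^sup>2) :: real)"
  proof -
    have "((2 * y + x) / 2)\<^sup>2 + (- x * sqrt 3 / 2)\<^sup>2 = x\<^sup>2 + x * y + y\<^sup>2" for x y :: real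
      by (simp add: power_divide power_mult_distrib power2_sum field_simps)
    from this[of "of_int b - of_int d" "of_int a - of_int c"] show ?thesis
      by (simp only: of_int_add of_int_diff of_int_mult of_int_power)
  qed
  finally show ?thesis .
qed

lemma dist_vtx_le: "dist (vtx a b) (vtx c d) \<le> \<bar>of_int (a - c)\<bar> + \<bar>of_int (b - d)\<bar>"
proof (rule power2_le_imp_le)
  have "(a - c) * (b - d) \<le> 2 * (\<bar>a - c\<bar> * \<bar>b - d\<bar>)"
    using abs_ge_self[of "(a - c) * (b - d)"] mult_nonneg_nonneg[of "\<bar>a - c\<bar>" "\<bar>b - d\<bar>"]
    unfolding abs_mult by linarith
  then have "(a - c)\<^sup>2 + (a - c) * (b - d) + (b - d)\<^sup>2 \<le> (\<bar>a - c\<bar> + \<bar>b - d\<bar>)\<^sup>2"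
    by (simp add: power2_sum)
  then have "of_int ((a - c)\<^sup>2 + (a - c) * (b - d) + (b - d)\<^sup>2)
      \<le> (of_int ((\<bar>a - c\<bar> + \<bar>b - d\<bar>)\<^sup>2) :: real)"
    by (simp only: of_int_le_iff)
  then show "(dist (vtx a b) (vtx c d))\<^sup>2 \<le> (\<bar>of_int (a - c)\<bar> + \<bar>of_int (b - d)\<bar>)\<^sup>2"
    unfolding dist_vtx by simp
qed simp

text \<open>Completing the square in either variable bounds the other by 1; the solutions are the
  six neighbors of a lattice point.\<close>

lemma loeschian_eq_1:
  fixes x y :: int
  assumes "x\<^sup>2 + x * y + y\<^sup>2 = 1"
  shows "(x, y) \<in> {(1, 0), (- 1, 0), (0, 1), (0, - 1), (1, - 1), (- 1, 1)}"
proof -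
  have "(2 * x + y)\<^sup>2 + 3 * y\<^sup>2 = 4" "(2 * y + x)\<^sup>2 + 3 * x\<^sup>2 = 4"
    using assms by (simp_all add: power2_eq_square algebra_simps)
  then have "3 * y\<^sup>2 \<le> 4" "3 * x\<^sup>2 \<le> 4"
    by (metis zero_le_power2 le_add_same_cancel2)+
  then have "y\<^sup>2 < 2\<^sup>2" "x\<^sup>2 < 2\<^sup>2" by simp_all
  then have "\<bar>y\<bar> < 2" "\<bar>x\<bar> < 2" using abs_square_less_1 power2_less_imp_less[of "\<bar>_\<bar>" 2] by force+
  then have "x = - 1 \<or> x = 0 \<or> x = 1" "y = - 1 \<or> y = 0 \<or> y = 1" by linarith+
  then show ?thesis using assms by auto
qed

lemma dist_vtx_eq_1: "dist (vtx a b) (vtx c d) = 1 \<longleftrightarrow> (a - c)\<^sup>2 + (a - c) * (b - d) + (b - d)\<^sup>2 = 1"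
proof -
  have "dist (vtx a b) (vtx c d) = 1 \<longleftrightarrow> (dist (vtx a b) (vtx c d))\<^sup>2 = 1"
    by (smt (verit) power2_eq_1_iff zero_le_dist)
  also have "\<dots> \<longleftrightarrow> (a - c)\<^sup>2 + (a - c) * (b - d) + (b - d)\<^sup>2 = 1"
    unfolding dist_vtx by (simp only: of_int_eq_1_iff)
  finally show ?thesis .
qed

section \<open>Sides and marks of a regular unit triangle\<close>

lemma regular_unit_not_collinear:
  assumes "regular_unit p q r"
  shows "\<not> collinear {p, q, r}"
proof
  assume "collinear {p, q, r}"
  moreover have "p \<noteq> r" using assms by (auto simp: regular_unit_def)
  ultimately obtain u where u: "q = u *\<^sub>R p + (1 - u) *\<^sub>R r" by (auto simp: collinear_3_expand)
  have "q - r = u *\<^sub>R (p - r)" "p - q = (1 - u) *\<^sub>R (p - r)"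
    unfolding u by (simp_all add: algebra_simps)
  moreover have "norm (q - r) = 1" "norm (p - q) = 1" "norm (p - r) = 1"
    using assms by (simp_all add: regular_unit_def dist_norm norm_minus_commute)
  ultimately have "\<bar>u\<bar> = 1" "\<bar>1 - u\<bar> = 1" by simp_all
  then show False by linarith
qed

text \<open>The faces of a simplex are the hulls of its sets of vertices, and dimension 1 selects
  the pairs.\<close>

lemma edge_of_regular_unit:
  assumes "regular_unit p q r"
  shows "{e. e edge_of convex hull {p, q, r}} =
    {closed_segment p q, closed_segment q r, closed_segment r p}"
proof -
  have ne: "p \<noteq> q" "q \<noteq> r" "p \<noteq> r" using assms by (auto simp: regular_unit_def)
  have ind: "\<not> affine_dependent {p, q, r}"
    using regular_unit_not_collinear[OF assms] by (simp add: collinear_3_eq_affine_dependent)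
  have "e edge_of convex hull {p, q, r} \<longleftrightarrow> (\<exists>c. c \<subseteq> {p, q, r} \<and> card c = 2 \<and> e = convex hull c)" for e
  proof -
    have "aff_dim (convex hull c) = 1 \<longleftrightarrow> card c = 2" if "c \<subseteq> {p, q, r}" for c
      using aff_dim_affine_independent[OF affine_independent_subset[OF ind that]]
      by (auto simp: aff_dim_convex_hull)
    then show ?thesis
      unfolding edge_of_def face_of_convex_hull_affine_independent[OF ind] by blast
  qed
  moreover have "c \<subseteq> {p, q, r} \<and> card c = 2 \<longleftrightarrow> c \<in> {{p, q}, {q, r}, {r, p}}" for c
  proof
    assume c: "c \<subseteq> {p, q, r} \<and> card c = 2"
    then obtain a b where "c = {a, b}" "a \<noteq> b" by (auto simp: card_2_iff)
    then show "c \<in> {{p, q}, {q, r}, {r, p}}" using c by auto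
  qed (use ne in auto)
  ultimately have "e edge_of convex hull {p, q, r} \<longleftrightarrow>
      (\<exists>c\<in>{{p, q}, {q, r}, {r, p}}. e = convex hull c)" for e
    by metis
  then show ?thesis by (simp only: segment_convex_hull bex_simps) blast
qed

lemma regular_unit_distinct_sides:
  assumes "regular_unit p q r"
  shows "closed_segment p q \<noteq> closed_segment q r" "closed_segment q r \<noteq> closed_segment r p"
    "closed_segment p q \<noteq> closed_segment r p"
proof -
  have ne: "p \<noteq> q" "q \<noteq> r" "p \<noteq> r" using assms by (auto simp: regular_unit_def)
  then show "closed_segment p q \<noteq> closed_segment q r" "closed_segment q r \<noteq> closed_segment r p"
    "closed_segment p q \<noteq> closed_segment r p"
    by (auto simp: doubleton_eq_iff)
qed

lemma red_sides_regular_unit: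
  assumes "regular_unit p q r"
  shows "red_sides S (convex hull {p, q, r}) =
    of_bool (folding_pattern S (closed_segment p q) = Red)
    + of_bool (folding_pattern S (closed_segment q r) = Red)
    + of_bool (folding_pattern S (closed_segment r p) = Red)"
proof -
  have "red_sides S (convex hull {p, q, r}) =
      card ({e. e edge_of convex hull {p, q, r}} \<inter> {e. folding_pattern S e = Red})"
    unfolding red_sides_def by (rule arg_cong[of _ _ card]) auto
  also have "\<dots> = (\<Sum>e\<in>{closed_segment p q, closed_segment q r, closed_segment r p}.
      of_bool (folding_pattern S e = Red))"
    unfolding edge_of_regular_unit[OF assms] by (simp add: sum_of_bool_eq del: closed_segment_eq)
  finally show ?thesis using regular_unit_distinct_sides[OF assms] by (simp del: closed_segment_eq)
qed

text \<open>Justifies the definite description in \<open>marked_side\<close>: among three sides in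
  two colors, not all equal, exactly one stands alone.\<close>

lemma marked_side_unique:
  assumes "regular_unit p q r" "T = convex hull {p, q, r}" "red_sides S T \<in> {1, 2}"
  shows "\<exists>!e. e edge_of T \<and>
    (\<forall>e'. e' edge_of T \<and> e' \<noteq> e \<longrightarrow> folding_pattern S e' \<noteq> folding_pattern S e)"
proof -
  define e1 where "e1 = closed_segment p q"
  define e2 where "e2 = closed_segment q r"
  define e3 where "e3 = closed_segment r p"
  have ne: "e1 \<noteq> e2" "e2 \<noteq> e3" "e1 \<noteq> e3"
    using regular_unit_distinct_sides[OF assms(1)] by (simp_all only: e1_def e2_def e3_def) auto
  have E: "e edge_of T \<longleftrightarrow> e = e1 \<or> e = e2 \<or> e = e3" for e
    using edge_of_regular_unit[OF assms(1)] assms(2) by (auto simp: e1_def e2_def e3_def)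
  have R: "of_bool (folding_pattern S e1 = Red) + of_bool (folding_pattern S e2 = Red)
     + of_bool (folding_pattern S e3 = Red) \<in> {1, 2::nat}"
    using red_sides_regular_unit[OF assms(1)] assms(2,3) by (simp only: e1_def e2_def e3_def)
  have odd_one: ?thesis if "e edge_of T" "\<And>g. g edge_of T \<Longrightarrow> g = e \<or> g = f \<or> g = f'"
    "f edge_of T" "f' edge_of T" "f \<noteq> f'" "f \<noteq> e" "f' \<noteq> e" "folding_pattern S f = folding_pattern S f'"
    "folding_pattern S f \<noteq> folding_pattern S e" for e f f'
    by (rule ex1I[of _ e]) (use that in metis)+
  have "(folding_pattern S e1 \<noteq> folding_pattern S e2 \<and> folding_pattern S e2 = folding_pattern S e3) \<or>
    (folding_pattern S e2 \<noteq> folding_pattern S e3 \<and> folding_pattern S e3 = folding_pattern S e1) \<or>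
    (folding_pattern S e3 \<noteq> folding_pattern S e1 \<and> folding_pattern S e1 = folding_pattern S e2)"
    using R by (cases "folding_pattern S e1"; cases "folding_pattern S e2"; cases "folding_pattern S e3"; simp)
  then show ?thesis
  proof (elim disjE conjE)
    assume "folding_pattern S e1 \<noteq> folding_pattern S e2" "folding_pattern S e2 = folding_pattern S e3"
    then show ?thesis by (intro odd_one[of e1 e2 e3]) (use E ne in auto)
  next
    assume "folding_pattern S e2 \<noteq> folding_pattern S e3" "folding_pattern S e3 = folding_pattern S e1"
    then show ?thesis by (intro odd_one[of e2 e3 e1]) (use E ne in auto)
  next
    assume "folding_pattern S e3 \<noteq> folding_pattern S e1" "folding_pattern S e1 = folding_pattern S e2"
    then show ?thesis by (intro odd_one[of e3 e1 e2]) (use E ne in auto)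
  qed
qed

lemma regular_unit_translate: "regular_unit (v + p) (v + q) (v + r) \<longleftrightarrow> regular_unit p q r"
  by (simp add: regular_unit_def)

lemma translate_triangle: "(+) v ` (convex hull {p, q, r}) = convex hull {v + p, v + q, v + r}"
  using convex_hull_translation[of v "{p, q, r}"] by simp

lemma edge_of_translate:
  assumes "regular_unit p q r" "T = convex hull {p, q, r}"
  shows "e edge_of (+) v ` T \<longleftrightarrow> (\<exists>e'. e = (+) v ` e' \<and> e' edge_of T)"
proof -
  have "{e. e edge_of (+) v ` T} = (`) ((+) v) ` {e. e edge_of T}"
    unfolding assms(2) translate_triangle edge_of_regular_unit[OF assms(1)]
    using edge_of_regular_unit[of "v + p" "v + q" "v + r"] assms(1)
    by (simp add: regular_unit_translate closed_segment_translation)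
  then show ?thesis by blast
qed

text \<open>Reduces decorations to edge colors: the translate of the odd side is odd again, and
  uniqueness identifies it.\<close>

lemma marked_side_translate:
  assumes reg: "regular_unit p q r" "T = convex hull {p, q, r}"
    and col: "\<And>e. e edge_of T \<Longrightarrow> folding_pattern S ((+) v ` e) = folding_pattern S e"
    and red: "red_sides S ((+) v ` T) = red_sides S T"
  shows "marked_side S ((+) v ` T) = map_option ((`) ((+) v)) (marked_side S T)"
proof (cases "red_sides S T \<in> {1, 2}")
  case True
  let ?P = "\<lambda>T e. e edge_of T \<and>
    (\<forall>e'. e' edge_of T \<and> e' \<noteq> e \<longrightarrow> folding_pattern S e' \<noteq> folding_pattern S e)"
  have P: "?P T (THE e. ?P T e)" using theI'[OF marked_side_unique[OF reg True]] .
  have "regular_unit (v + p) (v + q) (v + r)" using reg(1) by (simp add: regular_unit_translate)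
  moreover have "(+) v ` T = convex hull {v + p, v + q, v + r}" by (simp add: reg(2) translate_triangle)
  ultimately have "\<exists>!e. ?P ((+) v ` T) e"
    using marked_side_unique[of "v + p" "v + q" "v + r"] True red by simp
  moreover have "?P ((+) v ` T) ((+) v ` (THE e. ?P T e))"
  proof (intro conjI allI impI)
    show "((+) v ` (THE e. ?P T e)) edge_of ((+) v ` T)"
      using P unfolding edge_of_translate[OF reg] by blast
    fix e' assume "e' edge_of ((+) v ` T) \<and> e' \<noteq> (+) v ` (THE e. ?P T e)"
    then obtain e where e: "e' = (+) v ` e" "e edge_of T" "e \<noteq> (THE e. ?P T e)"
      unfolding edge_of_translate[OF reg] by blast
    then have "folding_pattern S e \<noteq> folding_pattern S (THE e. ?P T e)" using P by blast
    then show "folding_pattern S e' \<noteq> folding_pattern S ((+) v ` (THE e. ?P T e))"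
      using col[OF e(2)] col[OF P[THEN conjunct1]] e(1) by simp
  qed
  ultimately have "(THE e. ?P ((+) v ` T) e) = (+) v ` (THE e. ?P T e)" by (rule the1_equality)
  then show ?thesis using True red by (simp add: marked_side_def)
next
  case False
  then show ?thesis using red by (simp add: marked_side_def)
qed

text \<open>\<open>pos 0 0\<close> is \<open>T0\<close>. The tiles \<open>pos a b\<close> and
  \<open>neg a b\<close> lie above and below their common horizontal side
  \<open>edge 1 a b\<close>.\<close>

definition pos :: "int \<Rightarrow> int \<Rightarrow> plane set" where
  "pos a b = convex hull {vtx a b, vtx a (b - 1), vtx (a - 1) b}"

definition neg :: "int \<Rightarrow> int \<Rightarrow> plane set" where
  "neg a b = convex hull {vtx a b, vtx a (b - 1), vtx (a + 1) (b - 1)}"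

lemma regular_unit_pos: "regular_unit (vtx a b) (vtx a (b - 1)) (vtx (a - 1) b)"
  by (simp add: regular_unit_def dist_vtx_eq_1)

lemma regular_unit_neg: "regular_unit (vtx a b) (vtx a (b - 1)) (vtx (a + 1) (b - 1))"
  by (simp add: regular_unit_def dist_vtx_eq_1)

lemma edge_of_pos: "{e. e edge_of pos a b} = {edge 1 a b, edge 3 a (b - 1), edge 2 a b}"
  unfolding pos_def edge_of_regular_unit[OF regular_unit_pos]
  by (simp add: edge_def closed_segment_commute[of "vtx (a - 1) b"])

lemma edge_of_neg:
  "{e. e edge_of neg a b} = {edge 1 a b, edge 2 (a + 1) (b - 1), edge 3 (a + 1) (b - 1)}"
  unfolding neg_def edge_of_regular_unit[OF regular_unit_neg]
  by (simp add: edge_def closed_segment_commute[of "vtx a (b - 1)"])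

lemma red_sides_pos:
  "red_sides S (pos a b) = of_bool (folding_pattern S (edge 1 a b) = Red)
    + of_bool (folding_pattern S (edge 2 a b) = Red)
    + of_bool (folding_pattern S (edge 3 a (b - 1)) = Red)"
  unfolding pos_def red_sides_regular_unit[OF regular_unit_pos]
  by (simp add: edge_def closed_segment_commute[of "vtx (a - 1) b"])

section \<open>The unit triangles are exactly the indexed tiles\<close>

lemma segment_subset_grid:
  assumes "p \<in> grid_line i n" "q \<in> grid_line i n" "i \<in> {1,2,3}"
  shows "closed_segment p q \<subseteq> grid"
proof
  fix x assume "x \<in> closed_segment p q"
  then obtain u where "x = (1 - u) *\<^sub>R p + u *\<^sub>R q" by (auto simp: in_segment)
  then have "x \<bullet> xi i = (1 - u) * (p \<bullet> xi i) + u * (q \<bullet> xi i)" by (simp add: inner_add_left)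
  then have "x \<in> grid_line i n"
    using assms(1,2) by (simp add: grid_line_def algebra_simps)
  then show "x \<in> grid" using assms(3) unfolding grid_def by blast
qed

lemma vtx_grid_line:
  "vtx a b \<in> grid_line 1 a" "vtx a b \<in> grid_line 2 b" "vtx a b \<in> grid_line 3 (- a - b - 1)"
  by (simp_all add: grid_line_def vtx_inner_xi)

lemma pos_unit_triangle: "pos a b \<in> unit_triangles"
proof -
  have "closed_segment (vtx a b) (vtx a (b - 1)) \<subseteq> grid"
    by (rule segment_subset_grid[of _ 1 a]) (simp_all add: vtx_grid_line)
  moreover have "closed_segment (vtx (a - 1) b) (vtx a b) \<subseteq> grid"
    by (rule segment_subset_grid[of _ 2 b]) (simp_all add: vtx_grid_line)
  moreover have "closed_segment (vtx a (b - 1)) (vtx (a - 1) b) \<subseteq> grid"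
    by (rule segment_subset_grid[of _ 3 "- a - b"])
      (use vtx_grid_line(3)[of a "b - 1"] vtx_grid_line(3)[of "a - 1" b] in simp_all)
  ultimately show ?thesis
    unfolding unit_triangles_def pos_def using regular_unit_pos by blast
qed

text \<open>A counting argument: a grid line that does not contain both end points meets the segment
  at most once, there are only countably many grid lines, and a proper segment is
  uncountable.\<close>

lemma segment_in_grid_line:
  assumes "p \<noteq> q" "closed_segment p q \<subseteq> grid"
  shows "\<exists>i\<in>{1,2,3}. \<exists>n. p \<in> grid_line i n \<and> q \<in> grid_line i n"
proof (rule ccontr)
  assume no: "\<not> ?thesis"
  have "countable (closed_segment p q \<inter> grid_line i n)" if "i \<in> {1,2,3}" for i n
  proof (cases "\<exists>x y. x \<in> closed_segment p q \<inter> grid_line i n \<and> y \<in> closed_segment p q \<inter> grid_line i n \<and> x \<noteq> y")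
    case True
    then obtain u w where "(1 - u) *\<^sub>R p + u *\<^sub>R q \<in> grid_line i n"
      "(1 - w) *\<^sub>R p + w *\<^sub>R q \<in> grid_line i n" "u \<noteq> w"
      unfolding in_segment Int_iff by blast
    then have e: "(1 - u) * (p \<bullet> xi i) + u * (q \<bullet> xi i) = 3 * of_int n + 1"
      "(1 - w) * (p \<bullet> xi i) + w * (q \<bullet> xi i) = 3 * of_int n + 1"
      by (auto simp: grid_line_def inner_add_left)
    then have "(u - w) * (p \<bullet> xi i - q \<bullet> xi i) = 0" by (simp add: algebra_simps)
    then have "p \<bullet> xi i = q \<bullet> xi i" using \<open>u \<noteq> w\<close> by simp
    then have "p \<in> grid_line i n \<and> q \<in> grid_line i n"
      using e(1) by (simp add: grid_line_def algebra_simps)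
    then show ?thesis using no that by blast
  next
    case False
    then have "finite (closed_segment p q \<inter> grid_line i n)"
      by (metis finite.simps is_singletonI' is_singleton_def)
    then show ?thesis by (rule countable_finite)
  qed
  then have "countable (\<Union>i\<in>{1,2,3}. \<Union>n. closed_segment p q \<inter> grid_line i n)"
    by (intro countable_UN) auto
  moreover have "closed_segment p q \<subseteq> (\<Union>i\<in>{1,2,3}. \<Union>n. closed_segment p q \<inter> grid_line i n)"
    using assms(2) unfolding grid_def by blast
  ultimately show False
    using uncountable_closed_segment[OF assms(1)] countable_subset by blast
qed

lemma grid_lines_meet_vtx:
  assumes "p \<in> grid_line i n" "p \<in> grid_line j m" "i \<in> {1,2,3}" "j \<in> {1,2,3}" "i \<noteq> j"
  shows "\<exists>a b. p = vtx a b"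
proof -
  have "\<exists>a b. p \<bullet> xi 1 = 3 * real_of_int a + 1 \<and> p \<bullet> xi 2 = 3 * real_of_int b + 1"
  proof -
    \<comment> \<open>The index of the third grid line through \<open>p\<close>, forced by the zero
      sum of the coordinates.\<close>
    define c where "c = - n - m - 1"
    have "real_of_int c = - real_of_int n - real_of_int m - 1" by (simp add: c_def)
    moreover have "p \<bullet> xi i = 3 * of_int n + 1" "p \<bullet> xi j = 3 * of_int m + 1"
      using assms by (auto simp: grid_line_def)
    ultimately have "\<exists>a\<in>{n,m,c}. \<exists>b\<in>{n,m,c}. p \<bullet> xi 1 = 3 * real_of_int a + 1 \<and> p \<bullet> xi 2 = 3 * real_of_int b + 1"
      using inner_xi_sum[of p] assms(3-5) by auto
    then show ?thesis by blast
  qed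
  then show ?thesis using eq_vtxI by blast
qed

text \<open>The squares of the three coordinate differences add up to 18 times the squared distance;
  here one difference is 0 and the other two are opposite.\<close>

lemma dist_on_grid_line:
  assumes "i \<in> {1,2,3}" "j \<in> {1,2,3}" "i \<noteq> j" "p \<bullet> xi i = q \<bullet> xi i" "dist p q = 1"
  shows "p \<bullet> xi j - q \<bullet> xi j = 3 \<or> p \<bullet> xi j - q \<bullet> xi j = - 3"
proof -
  define d where "d = p - q"
  have z: "d \<bullet> xi i = 0" using assms(4) by (simp add: d_def inner_diff_left)
  have "18 * (d \<bullet> d) = (d \<bullet> xi 1)\<^sup>2 + (d \<bullet> xi 2)\<^sup>2 + (d \<bullet> xi 3)\<^sup>2"
    unfolding inner_xi by (simp add: inner_vec_def sum_2 power2_eq_square algebra_simps)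
  moreover have "d \<bullet> d = 1" using assms(5)
    by (simp add: d_def dist_norm power2_norm_eq_inner[symmetric])
  moreover have "(d \<bullet> xi 1)\<^sup>2 + (d \<bullet> xi 2)\<^sup>2 + (d \<bullet> xi 3)\<^sup>2 = 2 * (d \<bullet> xi j)\<^sup>2"
  proof -
    have *: "a\<^sup>2 = b\<^sup>2" if "a + b = 0" for a b :: real
      using that by (metis add_eq_0_iff power2_minus)
    show ?thesis using assms(1-3) z inner_xi_sum[of d]
      *[of "d \<bullet> xi 1" "d \<bullet> xi 2"] *[of "d \<bullet> xi 1" "d \<bullet> xi 3"] *[of "d \<bullet> xi 2" "d \<bullet> xi 3"] by auto
  qed
  ultimately have "(d \<bullet> xi j)\<^sup>2 = 3\<^sup>2" by simp
  then have "d \<bullet> xi j = 3 \<or> d \<bullet> xi j = - 3" by (simp only: power2_eq_iff)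
  then show ?thesis by (simp add: d_def inner_diff_left)
qed

text \<open>Sides of the same direction share \<open>q\<close>, hence the line. Along it the round
  trip through \<open>p\<close>, \<open>q\<close>, \<open>r\<close> would consist of three steps of
  3 or - 3 with sum 0.\<close>

lemma grid_lines_of_sides_distinct:
  assumes "regular_unit p q r" "i \<in> {1,2,3}" "p \<in> grid_line i n" "q \<in> grid_line i n" "r \<in> grid_line i m"
    "q \<in> grid_line i m"
  shows False
proof -
  have "1 \<in> {1,2,3::nat}" "2 \<in> {1,2,3::nat}" by simp_all
  then obtain j :: nat where j: "j \<in> {1,2,3}" "i \<noteq> j" by (metis one_eq_numeral_iff semiring_norm(85))
  have l: "p \<bullet> xi i = q \<bullet> xi i" "q \<bullet> xi i = r \<bullet> xi i" "r \<bullet> xi i = p \<bullet> xi i"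
    using assms by (auto simp: grid_line_def)
  have d: "dist p q = 1" "dist q r = 1" "dist r p = 1" using assms(1) by (auto simp: regular_unit_def)
  show False
    using dist_on_grid_line[OF assms(2) j l(1) d(1)] dist_on_grid_line[OF assms(2) j l(2) d(2)]
      dist_on_grid_line[OF assms(2) j l(3) d(3)]
    by linarith
qed

text \<open>The sides have three different directions, so each corner is a crossing of two grid
  lines and thus some \<open>vtx a b\<close>. What remains is a finite check of unit
  distances.\<close>

lemma unit_triangle_cases:
  assumes "T \<in> unit_triangles"
  shows "\<exists>a b. T = pos a b \<or> T = neg a b"
proof -
  obtain p q r where T: "T = convex hull {p, q, r}" and reg: "regular_unit p q r"
    and g: "closed_segment p q \<subseteq> grid" "closed_segment q r \<subseteq> grid" "closed_segment r p \<subseteq> grid"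
    using assms unfolding unit_triangles_def by blast
  have ne: "p \<noteq> q" "q \<noteq> r" "r \<noteq> p" using reg by (auto simp: regular_unit_def)
  have reg': "regular_unit q r p" "regular_unit r p q" using reg by (auto simp: regular_unit_def)
  obtain i n where i: "i \<in> {1,2,3}" "p \<in> grid_line i n" "q \<in> grid_line i n"
    using segment_in_grid_line[OF ne(1) g(1)] by blast
  obtain j m where j: "j \<in> {1,2,3}" "q \<in> grid_line j m" "r \<in> grid_line j m"
    using segment_in_grid_line[OF ne(2) g(2)] by blast
  obtain k l where k: "k \<in> {1,2,3}" "r \<in> grid_line k l" "p \<in> grid_line k l"
    using segment_in_grid_line[OF ne(3) g(3)] by blast
  have "i \<noteq> j" "j \<noteq> k" "k \<noteq> i"
    using grid_lines_of_sides_distinct[OF reg] grid_lines_of_sides_distinct[OF reg'(1)]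
      grid_lines_of_sides_distinct[OF reg'(2)] i j k by blast+
  then obtain a b c d e f where v: "p = vtx a b" "q = vtx c d" "r = vtx e f"
    using grid_lines_meet_vtx i j k by metis
  have d: "(a - c, b - d) \<in> {(1, 0), (- 1, 0), (0, 1), (0, - 1), (1, - 1), (- 1, 1)}"
    "(c - e, d - f) \<in> {(1, 0), (- 1, 0), (0, 1), (0, - 1), (1, - 1), (- 1, 1)}"
    "(e - a, f - b) \<in> {(1, 0), (- 1, 0), (0, 1), (0, - 1), (1, - 1), (- 1, 1)}"
    using reg loeschian_eq_1 unfolding regular_unit_def v dist_vtx_eq_1 by blast+
  define x where "x = c - a"
  define y where "y = d - b"
  define z where "z = e - a"
  define w where "w = f - b"
  note xyzw = x_def y_def z_def w_def
  have cd: "c = a + x" "d = b + y" "e = a + z" "f = b + w" by (simp_all add: xyzw)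
  \<comment> \<open>The ordered pairs of neighbors of \<open>p\<close> at distance 1 from each
    other: two orders for each of the six tiles around \<open>p\<close>.\<close>
  have "(x, y, z, w) \<in> {(0,-1,-1,0), (-1,0,0,-1), (0,1,-1,1), (-1,1,0,1), (1,0,1,-1), (1,-1,1,0),
     (0,-1,1,-1), (1,-1,0,-1), (0,1,1,0), (1,0,0,1), (-1,0,-1,1), (-1,1,-1,0)}"
  proof -
    have "(x, y) \<in> {(1, 0), (- 1, 0), (0, 1), (0, - 1), (1, - 1), (- 1, 1)}"
      using d(1) unfolding cd by simp presburger
    moreover have "(z, w) \<in> {(1, 0), (- 1, 0), (0, 1), (0, - 1), (1, - 1), (- 1, 1)}"
      using d(3) unfolding cd by simp
    moreover have "(x - z, y - w) \<in> {(1, 0), (- 1, 0), (0, 1), (0, - 1), (1, - 1), (- 1, 1)}"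
      using d(2) unfolding cd by simp
    ultimately show ?thesis by (elim insertE emptyE; simp)
  qed
  then have "\<exists>a' b'. {vtx a b, vtx c d, vtx e f} = {vtx a' b', vtx a' (b' - 1), vtx (a' - 1) b'}
    \<or> {vtx a b, vtx c d, vtx e f} = {vtx a' b', vtx a' (b' - 1), vtx (a' + 1) (b' - 1)}"
  proof -
    have pos: "?thesis" if "{vtx a b, vtx c d, vtx e f} = {vtx a' b', vtx a' (b' - 1), vtx (a' - 1) b'}" for a' b'
      using that by blast
    have neg: "?thesis" if "{vtx a b, vtx c d, vtx e f} = {vtx a' b', vtx a' (b' - 1), vtx (a' + 1) (b' - 1)}" for a' b'
      using that by blast
    assume "(x, y, z, w) \<in> {(0,-1,-1,0), (-1,0,0,-1), (0,1,-1,1), (-1,1,0,1), (1,0,1,-1), (1,-1,1,0),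
     (0,-1,1,-1), (1,-1,0,-1), (0,1,1,0), (1,0,0,1), (-1,0,-1,1), (-1,1,-1,0)}"
    then consider "(x, y, z, w) \<in> {(0,-1,-1,0), (-1,0,0,-1)}" | "(x, y, z, w) \<in> {(0,1,-1,1), (-1,1,0,1)}"
      | "(x, y, z, w) \<in> {(1,0,1,-1), (1,-1,1,0)}" | "(x, y, z, w) \<in> {(0,-1,1,-1), (1,-1,0,-1)}"
      | "(x, y, z, w) \<in> {(0,1,1,0), (1,0,0,1)}" | "(x, y, z, w) \<in> {(-1,0,-1,1), (-1,1,-1,0)}" by (elim insertE emptyE) simp_all
    then show ?thesis
    proof cases
      case 1 then show ?thesis by (intro pos[of a b]) (auto simp: cd)
    next
      case 2 then show ?thesis by (intro pos[of a "b + 1"]) (auto simp: cd)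
    next
      case 3 then show ?thesis by (intro pos[of "a + 1" b]) (auto simp: cd)
    next
      case 4 then show ?thesis by (intro neg[of a b]) (auto simp: cd)
    next
      case 5 then show ?thesis by (intro neg[of a "b + 1"]) (auto simp: cd)
    next
      case 6 then show ?thesis by (intro neg[of "a - 1" "b + 1"]) (auto simp: cd)
    qed
  qed
  then show ?thesis unfolding T v pos_def neg_def by metis
qed

subsection \<open>Local derivation of the edge colors\<close>

text \<open>If an index is odd, the tile is a corner tile, and its middle edge belongs to a triangle
  of the other orientation. This edge has the opposite color, so the count cannot be the extreme
  one.\<close>

lemma red_sides_pos_centre:
  "red_sides S (pos a b) = (if S 0 = Up then 3 else 0) \<longleftrightarrow> even a \<and> even b"
proof -
  have 1: "folding_pattern S (edge 1 a b) = Red \<longleftrightarrow> (S 0 = Up) = even b" if "even a"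
    using edge_1_mid_color[OF that, of S b] by (simp only:) auto
  have 2: "folding_pattern S (edge 2 a b) = Red \<longleftrightarrow> (S 0 = Up) = even a" if "even b"
    using edge_2_mid_color[OF that, of S a] by (simp only:) auto
  have 3: "folding_pattern S (edge 3 a (b - 1)) = Red \<longleftrightarrow> (S 0 = Up) = even a" if "even (a + b)"
  proof -
    have "odd (a + (b - 1))" using that by simp
    from edge_3_mid_color[OF this, of S] show ?thesis by (simp only:) auto
  qed
  show ?thesis
  proof (cases "even a"; cases "even b")
    assume "even a" "even b"
    then show ?thesis using 1 2 3 by (simp add: red_sides_pos)
  next
    assume "even a" "odd b"
    then show ?thesis using 1 by (auto simp: red_sides_pos)
  next
    assume "odd a" "even b"
    then show ?thesis using 2 by (auto simp: red_sides_pos)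
  next
    assume "odd a" "odd b"
    then show ?thesis using 3 by (auto simp: red_sides_pos)
  qed
qed

text \<open>
  Each corner tile of a side-2 triangle counts the red edges among its known middle edge and two of the
  three sides of that triangle; three pairwise sums determine the three summands.
\<close>

lemma coarse_triangle_colors:
  assumes "odd a" "odd b" "even d" "even e"
    and "red_sides S (pos (a + d) (b + e)) = red_sides S (pos a b)"
    and "red_sides S (pos (a + d) (b - 1 + e)) = red_sides S (pos a (b - 1))"
    and "red_sides S (pos (a - 1 + d) (b + e)) = red_sides S (pos (a - 1) b)"
  shows "folding_pattern S (edge 1 (a + d) (b + e)) = folding_pattern S (edge 1 a b)"
    and "folding_pattern S (edge 2 (a + d) (b + e)) = folding_pattern S (edge 2 a b)"
    and "folding_pattern S (edge 3 (a - 1 + d) (b - 1 + e)) = folding_pattern S (edge 3 (a - 1) (b - 1))"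
proof -
  define F where "F i a b = (of_bool (folding_pattern S (edge i a b) = Red) :: nat)" for i a b
  have F_eq: "F i a b = F j c d" if "folding_pattern S (edge i a b) = folding_pattern S (edge j c d)"
    for i a b j c d using that by (simp add: F_def)
  have R: "red_sides S (pos a b) = F 1 a b + F 2 a b + F 3 a (b - 1)" for a b
    by (simp add: red_sides_pos F_def)
  \<comment> \<open>Identifying the two halves of each side leaves three unknowns:
    \<open>F 1 a b\<close>, \<open>F 2 a b\<close> and \<open>F 3 (a - 1) (b - 1)\<close>.\<close>
  have H: "F 1 a (b - 1) = F 1 a b" "F 2 (a - 1) b = F 2 a b" "F 3 a (b - 2) = F 3 (a - 1) (b - 1)"
    if "odd a" "odd b" for a b
  proof -
    show "F 1 a (b - 1) = F 1 a b"
      using edge_1_half_color[of a "b - 1" S] that by (intro F_eq) simp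
    show "F 2 (a - 1) b = F 2 a b"
      using edge_2_half_color[of "a - 1" b S] that by (intro F_eq) simp
    show "F 3 a (b - 2) = F 3 (a - 1) (b - 1)"
      using edge_3_half_color[of "a - 1" "b - 1" S] that by (intro F_eq) simp
  qed
  have M: "F 1 (a + d) (b + e) = F 1 a b" if "even a" for a b
    by (rule F_eq) (simp add: edge_1_mid_color that assms(3,4))
  have M2: "F 2 (a + d) (b + e) = F 2 a b" if "even b" for a b
    by (rule F_eq) (simp add: edge_2_mid_color that assms(3,4))
  have M3: "F 3 (a + d) (b + e) = F 3 a b" if "odd (a + b)" for a b
  proof -
    have "odd (a + d + (b + e))" using that assms(3,4) by simp
    then show ?thesis by (intro F_eq) (simp add: edge_3_mid_color that assms(3,4))
  qed
  have od: "odd (a + d)" "odd (b + e)" using assms by simp_all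
  note H1 = H[OF assms(1,2)] and H2 = H[OF od]
  have ar: "a + d - 1 = a - 1 + d" "b + e - 1 = b - 1 + e" "b - 1 + e - 1 = b - 2 + e"
    "b + e - 2 = b - 2 + e" "b - 1 - 1 = b - 2" by simp_all
  note H2 = H2[unfolded ar]
  have m: "F 3 (a + d) (b - 1 + e) = F 3 a (b - 1)" "F 2 (a + d) (b - 1 + e) = F 2 a (b - 1)"
    "F 1 (a - 1 + d) (b + e) = F 1 (a - 1) b"
    using M3[of a "b - 1"] M2[of "b - 1" a] M[of "a - 1" b] assms(1,2) by simp_all
  note r = assms(5-7)[unfolded R ar]
  have "F 1 (a + d) (b + e) = F 1 a b" "F 2 (a + d) (b + e) = F 2 a b"
    "F 3 (a - 1 + d) (b - 1 + e) = F 3 (a - 1) (b - 1)"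
    using r H1 H2 m by linarith+
  moreover have "x = y" if "(of_bool (x = Red) :: nat) = of_bool (y = Red)" for x y
    using that by (cases x; cases y) auto
  ultimately show "folding_pattern S (edge 1 (a + d) (b + e)) = folding_pattern S (edge 1 a b)"
    "folding_pattern S (edge 2 (a + d) (b + e)) = folding_pattern S (edge 2 a b)"
    "folding_pattern S (edge 3 (a - 1 + d) (b - 1 + e)) = folding_pattern S (edge 3 (a - 1) (b - 1))"
    unfolding F_def by blast+
qed

text \<open>A middle edge is colored by parities, which even shifts preserve. Any other edge is half
  of a side of a triangle of side 2 with positive corner tiles, indexed by a nearby pair of odd
  numbers.\<close>

lemma edge_colors_from_red_sides:
  assumes "even d" "even e"
    and red: "\<And>a' b'. \<bar>a' - a\<bar> \<le> 2 \<Longrightarrow> \<bar>b' - b\<bar> \<le> 2 \<Longrightarrow>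
      red_sides S (pos (a' + d) (b' + e)) = red_sides S (pos a' b')"
    and "i \<in> {1,2,3}"
  shows "folding_pattern S (edge i (a + d) (b + e)) = folding_pattern S (edge i a b)"
proof -
  have tri: "folding_pattern S (edge 1 (a' + d) (b' + e)) = folding_pattern S (edge 1 a' b')"
    "folding_pattern S (edge 2 (a' + d) (b' + e)) = folding_pattern S (edge 2 a' b')"
    "folding_pattern S (edge 3 (a' - 1 + d) (b' - 1 + e)) = folding_pattern S (edge 3 (a' - 1) (b' - 1))"
    if "odd a'" "odd b'" "a \<le> a'" "a' \<le> a + 1" "b \<le> b'" "b' \<le> b + 2" for a' b'
    using coarse_triangle_colors[OF that(1,2) assms(1,2), of S] red[of a' b'] red[of a' "b' - 1"]
      red[of "a' - 1" b'] that by simp_all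
  have 1: "folding_pattern S (edge 1 (a + d) (b + e)) = folding_pattern S (edge 1 a b)"
  proof (cases "even a")
    case True
    then show ?thesis by (simp add: edge_1_mid_color assms(1,2))
  next
    case odd: False
    show ?thesis
    proof (cases "even b")
      case True
      show ?thesis
        using tri(1)[of a "b + 1"] edge_1_half_color[of a b S] edge_1_half_color[of "a + d" "b + e" S]
          odd True assms(1,2) by (simp add: ac_simps)
    qed (use tri(1)[of a b] odd in simp)
  qed
  have 2: "folding_pattern S (edge 2 (a + d) (b + e)) = folding_pattern S (edge 2 a b)"
  proof (cases "even b")
    case True
    then show ?thesis by (simp add: edge_2_mid_color assms(1,2))
  next
    case odd: False
    show ?thesis
    proof (cases "even a")
      case True
      show ?thesis
        using tri(2)[of "a + 1" b] edge_2_half_color[of a b S] edge_2_half_color[of "a + d" "b + e" S]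
          odd True assms(1,2) by (simp add: ac_simps)
    qed (use tri(2)[of a b] odd in simp)
  qed
  have 3: "folding_pattern S (edge 3 (a + d) (b + e)) = folding_pattern S (edge 3 a b)"
  proof (cases "odd (a + b)")
    case True
    moreover from this have "odd (a + d + (b + e))" using assms(1,2) by simp
    ultimately show ?thesis by (simp add: edge_3_mid_color assms(1,2))
  next
    case even: False
    show ?thesis
    proof (cases "even a")
      case True
      then show ?thesis using tri(3)[of "a + 1" "b + 1"] even by simp
    next
      case False
      \<comment> \<open>Here \<open>edge 3 a b\<close> is the second half of the side whose first
        half is \<open>edge 3 (a - 1) (b + 1)\<close>. The triangle then has indices
        \<open>a\<close> and \<open>b + 2\<close>, the farthest ones used, whence the bound
        2.\<close>
      have ar: "b + 2 - 1 = b + 1" "b + e + 1 = b + 1 + e" "a + d - 1 = a - 1 + d"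
        "a - 1 + d + 1 = a + d" "b + 1 + e - 1 = b + e" by simp_all
      show ?thesis
        using tri(3)[of a "b + 2"] edge_3_half_color[of "a - 1" "b + 1" S]
          edge_3_half_color[of "a + d - 1" "b + e + 1" S] even False assms(1,2)
        unfolding ar by simp
    qed
  qed
  show ?thesis using assms(4) 1 2 3 by auto
qed

section \<open>Tiles under an arbitrary translation\<close>

lemma pos_inner_xi_le:
  assumes "p \<in> pos a b"
  shows "p \<bullet> xi 1 \<le> 3 * of_int a + 1" "p \<bullet> xi 2 \<le> 3 * of_int b + 1"
    "p \<bullet> xi 3 \<le> - 3 * of_int a - 3 * of_int b + 1"
proof -
  have half: "p \<bullet> xi i \<le> c" if "vtx a b \<bullet> xi i \<le> c" "vtx a (b - 1) \<bullet> xi i \<le> c" "vtx (a - 1) b \<bullet> xi i \<le> c"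
    for i c
  proof -
    have "pos a b \<subseteq> {x. x \<bullet> xi i \<le> c}"
      unfolding pos_def using convex_halfspace_le[of "xi i" c] that
      by (intro hull_minimal) (auto simp: inner_commute)
    then show ?thesis using assms by blast
  qed
  show "p \<bullet> xi 1 \<le> 3 * of_int a + 1" "p \<bullet> xi 2 \<le> 3 * of_int b + 1"
    "p \<bullet> xi 3 \<le> - 3 * of_int a - 3 * of_int b + 1"
    by (rule half; simp add: vtx_inner_xi)+
qed

lemma vtx_in_pos: "vtx a b \<in> pos a b" "vtx a (b - 1) \<in> pos a b" "vtx (a - 1) b \<in> pos a b"
  unfolding pos_def by (auto intro: hull_inc)

lemma vtx_in_neg: "vtx a b \<in> neg a b" "vtx a (b - 1) \<in> neg a b" "vtx (a + 1) (b - 1) \<in> neg a b"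
  unfolding neg_def by (auto intro: hull_inc)

lemma in_translated_pos:
  assumes "p \<in> (+) v ` pos a b"
  shows "p \<bullet> xi 1 \<le> v \<bullet> xi 1 + 3 * of_int a + 1" "p \<bullet> xi 2 \<le> v \<bullet> xi 2 + 3 * of_int b + 1"
    "p \<bullet> xi 3 \<le> v \<bullet> xi 3 - 3 * of_int a - 3 * of_int b + 1"
  using assms pos_inner_xi_le[of _ a b] by (fastforce simp: inner_add_left)+

text \<open>The maxima of the three coordinates add up to 3 on a positive tile and to 6 on a
  negative one, and translations preserve this sum.\<close>

lemma translated_pos_neq_neg: "(+) v ` pos a b \<noteq> neg c d"
proof
  assume "(+) v ` pos a b = neg c d"
  then have "vtx (c + 1) (d - 1) \<in> (+) v ` pos a b" "vtx c d \<in> (+) v ` pos a b"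
    "vtx c (d - 1) \<in> (+) v ` pos a b"
    using vtx_in_neg by auto
  from in_translated_pos(1)[OF this(1)] in_translated_pos(2)[OF this(2)] in_translated_pos(3)[OF this(3)]
  show False using inner_xi_sum[of v] by (simp add: vtx_inner_xi)
qed

text \<open>Turns a real vector into an integer shift: \<open>vtx a b\<close> is the vertex of
  \<open>pos a b\<close> where the first two coordinates are both maximal, so it must go to
  \<open>vtx c d\<close>.\<close>

lemma translated_pos_eq_pos:
  assumes "(+) v ` pos a b = pos c d"
  shows "v \<bullet> xi 1 = 3 * of_int (c - a)" "v \<bullet> xi 2 = 3 * of_int (d - b)"
proof -
  have "vtx c d \<in> (+) v ` pos a b" using vtx_in_pos assms by simp
  note b = in_translated_pos(1,2)[OF this]
  have "v + vtx a b \<in> pos c d" using vtx_in_pos[of a b] assms by blast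
  note b = b pos_inner_xi_le(1,2)[OF this]
  show "v \<bullet> xi 1 = 3 * of_int (c - a)" "v \<bullet> xi 2 = 3 * of_int (d - b)"
    using b by (simp_all add: vtx_inner_xi inner_add_left)
qed

lemma vtx_translate:
  assumes "v \<bullet> xi 1 = 3 * of_int d" "v \<bullet> xi 2 = 3 * of_int e"
  shows "v + vtx a b = vtx (a + d) (b + e)"
  by (rule eq_vtxI) (simp_all add: inner_add_left vtx_inner_xi assms)

lemma edge_translate:
  assumes "v \<bullet> xi 1 = 3 * of_int d" "v \<bullet> xi 2 = 3 * of_int e"
  shows "(+) v ` edge i a b = edge i (a + d) (b + e)"
  unfolding edge_def closed_segment_translation[symmetric]
  by (simp add: vtx_translate[OF assms] algebra_simps)

lemma pos_translate:
  assumes "v \<bullet> xi 1 = 3 * of_int d" "v \<bullet> xi 2 = 3 * of_int e"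
  shows "(+) v ` pos a b = pos (a + d) (b + e)"
  unfolding pos_def translate_triangle by (simp add: vtx_translate[OF assms] algebra_simps)

lemma unit_triangle_near:
  assumes "x \<in> T" "T = pos a b \<or> T = neg a b"
  shows "dist x (vtx a b) \<le> 1"
proof -
  have "{vtx a b, vtx a (b - 1), vtx (a - 1) b} \<subseteq> cball (vtx a b) 1"
    "{vtx a b, vtx a (b - 1), vtx (a + 1) (b - 1)} \<subseteq> cball (vtx a b) 1"
    using regular_unit_pos[of a b] regular_unit_neg[of a b]
    by (auto simp: regular_unit_def dist_commute)
  then have "pos a b \<subseteq> cball (vtx a b) 1" "neg a b \<subseteq> cball (vtx a b) 1"
    unfolding pos_def neg_def by (simp_all only: hull_minimal convex_cball)
  then have "x \<in> cball (vtx a b) 1" using assms by blast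
  then show ?thesis by (simp add: dist_commute)
qed

section \<open>Patches and mutual local derivability\<close>

lemma undecorated_eq:
  "undecorated_folding_tiling S =
    (\<lambda>T. \<lparr>support = T, orient = orientation_of T, reds = red_sides S T, mark = None\<rparr>) ` unit_triangles"
  by (simp add: undecorated_folding_tiling_def folding_tiling_def image_image)

lemma undecorated_patch_translate:
  assumes "translate v ` patch (undecorated_folding_tiling S) D = patch (undecorated_folding_tiling S) D'"
    and "T \<in> unit_triangles" "T \<inter> D \<noteq> {}"
  shows "(+) v ` T \<in> unit_triangles" "orientation_of ((+) v ` T) = orientation_of T"
    "red_sides S ((+) v ` T) = red_sides S T"
proof -
  let ?t = "\<lparr>support = T, orient = orientation_of T, reds = red_sides S T, mark = None\<rparr>"
  have "?t \<in> patch (undecorated_folding_tiling S) D"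
    using assms(2,3) by (simp add: patch_def undecorated_eq)
  then have "translate v ?t \<in> patch (undecorated_folding_tiling S) D'"
    using assms(1) by blast
  then have "translate v ?t \<in> undecorated_folding_tiling S"
    by (simp add: patch_def)
  then show "(+) v ` T \<in> unit_triangles" "orientation_of ((+) v ` T) = orientation_of T"
    "red_sides S ((+) v ` T) = red_sides S T"
    by (auto simp: undecorated_eq translate_def)
qed

text \<open>One central tile near \<open>T\<close> shows that \<open>v\<close> is an even shift of
  indices; the remaining tiles of the patch then transport the colors of the sides of
  \<open>T\<close>.\<close>

lemma undecorated_determines_marks:
  assumes eq: "translate v ` patch (undecorated_folding_tiling S) (cball x 10) =
      patch (undecorated_folding_tiling S) D"
    and T: "T \<in> unit_triangles" "x \<in> T"
  shows "marked_side S ((+) v ` T) = map_option ((`) ((+) v)) (marked_side S T)"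
proof -
  obtain a b where ab: "T = pos a b \<or> T = neg a b" using unit_triangle_cases[OF T(1)] by blast
  \<comment> \<open>The sides of \<open>T\<close> are off by at most 1 in each index and their
    colors use tiles 2 further away, so 4 is ample; \<open>1 + 4 + 4\<close> stays below the radius
    10.\<close>
  have near: "pos a' b' \<inter> cball x 10 \<noteq> {}" if "\<bar>a' - a\<bar> \<le> 4" "\<bar>b' - b\<bar> \<le> 4" for a' b'
  proof -
    have "dist x (vtx a' b') \<le> dist x (vtx a b) + dist (vtx a b) (vtx a' b')"
      by (rule dist_triangle)
    also have "\<dots> \<le> 1 + (\<bar>of_int (a - a')\<bar> + \<bar>of_int (b - b')\<bar>)"
      using unit_triangle_near[OF T(2) ab] dist_vtx_le by (rule add_mono)
    also have "\<dots> \<le> 1 + (4 + 4)"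
      using that by linarith
    finally show ?thesis using vtx_in_pos(1)[of a' b'] by auto
  qed
  note pos_tr = undecorated_patch_translate[OF eq pos_unit_triangle near]
  \<comment> \<open>Rounding down to even indices finds a central tile at most one step away in each
    index.\<close>
  define a0 where "a0 = 2 * (a div 2)"
  define b0 where "b0 = 2 * (b div 2)"
  have n0: "\<bar>a0 - a\<bar> \<le> 4" "\<bar>b0 - b\<bar> \<le> 4" "even a0" "even b0" by (auto simp: a0_def b0_def)
  obtain c0 d0 where "(+) v ` pos a0 b0 = pos c0 d0"
    using unit_triangle_cases[OF pos_tr(1)[OF n0(1,2)]] translated_pos_neq_neg by metis
  note tr = this translated_pos_eq_pos[OF this]
  define d where "d = c0 - a0"
  define e where "e = d0 - b0"
  have v: "v \<bullet> xi 1 = 3 * of_int d" "v \<bullet> xi 2 = 3 * of_int e"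
    using tr(2,3) by (simp_all add: d_def e_def)
  \<comment> \<open>Both tiles belong to the tiling of the same \<open>S\<close>, so the count
    typical of central tiles is the same for both, and the image is central too.\<close>
  have "red_sides S (pos c0 d0) = red_sides S (pos a0 b0)"
    using pos_tr(3)[OF n0(1,2)] tr(1) by simp
  then have "even c0 \<and> even d0" using red_sides_pos_centre[of S] n0(3,4) by metis
  then have even: "even d" "even e" using n0(3,4) by (simp_all add: d_def e_def)
  have red: "red_sides S (pos (a' + d) (b' + e)) = red_sides S (pos a' b')"
    if "\<bar>a' - a\<bar> \<le> 4" "\<bar>b' - b\<bar> \<le> 4" for a' b'
    using pos_tr(3)[OF that] pos_translate[OF v] by simp
  have col: "folding_pattern S ((+) v ` edge i a' b') = folding_pattern S (edge i a' b')"
    if "\<bar>a' - a\<bar> \<le> 1" "\<bar>b' - b\<bar> \<le> 1" "i \<in> {1,2,3}" for i a' b'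
    unfolding edge_translate[OF v]
    by (rule edge_colors_from_red_sides[OF even _ that(3)], rule red) (use that in linarith)+
  have col_T: "folding_pattern S ((+) v ` g) = folding_pattern S g" if "g edge_of T" for g
  proof -
    have "g \<in> {edge 1 a b, edge 3 a (b - 1), edge 2 a b} \<union>
        {edge 1 a b, edge 2 (a + 1) (b - 1), edge 3 (a + 1) (b - 1)}"
      using that ab edge_of_pos[of a b] edge_of_neg[of a b] by blast
    then show ?thesis by (auto intro!: col)
  qed
  have "T \<inter> cball x 10 \<noteq> {}" using T(2) by auto
  note T_red = undecorated_patch_translate(3)[OF eq T(1) this]
  show ?thesis
    using ab marked_side_translate[OF regular_unit_pos _ col_T T_red]
      marked_side_translate[OF regular_unit_neg _ col_T T_red]
    unfolding pos_def neg_def by blast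
qed

lemma translate_patch_singleton_subset:
  assumes eq: "translate (y - x) ` patch (undecorated_folding_tiling S) (cball x 10) =
      patch (undecorated_folding_tiling S) (cball y 10)"
  shows "translate (y - x) ` patch (folding_tiling S) {x} \<subseteq> patch (folding_tiling S) {y}"
proof
  fix t assume "t \<in> translate (y - x) ` patch (folding_tiling S) {x}"
  then obtain T where T: "T \<in> unit_triangles" "x \<in> T"
    and t: "t = translate (y - x)
      \<lparr>support = T, orient = orientation_of T, reds = red_sides S T, mark = marked_side S T\<rparr>"
    by (auto simp: patch_def folding_tiling_def)
  have "T \<inter> cball x 10 \<noteq> {}" using T(2) by auto
  note tr = undecorated_patch_translate[OF eq T(1) this] undecorated_determines_marks[OF eq T]
  let ?T = "(+) (y - x) ` T"
  have "t = \<lparr>support = ?T, orient = orientation_of ?T, reds = red_sides S ?T, mark = marked_side S ?T\<rparr>"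
    unfolding t using tr by (simp add: translate_def)
  moreover have "y \<in> ?T" using T(2) by (force simp: image_iff)
  ultimately show "t \<in> patch (folding_tiling S) {y}"
    using tr(1) by (auto simp: patch_def folding_tiling_def)
qed

lemma translate_minus: "translate (- v) (translate v t) = t"
  by (cases t) (simp add: translate_def image_image option.map_comp comp_def option.map_ident)

lemma translate_patch_symmetric:
  assumes "translate (y - x) ` A = B"
  shows "translate (x - y) ` B = A"
  using assms translate_minus[of "y - x"] by (auto simp: image_image)

lemma decorated_derivable: "locally_derivable (folding_tiling S) (undecorated_folding_tiling S)"
  unfolding locally_derivable_def
proof (intro exI[of _ 10] conjI allI impI)
  fix x y :: plane
  assume eq: "translate (y - x) ` patch (undecorated_folding_tiling S) (cball x 10) =
      patch (undecorated_folding_tiling S) (cball y 10)"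
  \<comment> \<open>The converse inclusion is the same statement with \<open>x\<close> and
    \<open>y\<close> exchanged, since translations are invertible on tiles.\<close>
  have "translate (x - y) ` patch (folding_tiling S) {y} \<subseteq> patch (folding_tiling S) {x}"
    by (rule translate_patch_singleton_subset[OF translate_patch_symmetric[OF eq]])
  then have "translate (y - x) ` translate (x - y) ` patch (folding_tiling S) {y} \<subseteq>
      translate (y - x) ` patch (folding_tiling S) {x}"
    by (rule image_mono)
  then have "patch (folding_tiling S) {y} \<subseteq> translate (y - x) ` patch (folding_tiling S) {x}"
    using translate_patch_symmetric[OF refl] by simp
  then show "translate (y - x) ` patch (folding_tiling S) {x} = patch (folding_tiling S) {y}"
    using translate_patch_singleton_subset[OF eq] by (rule subset_antisym[rotated])
qed simp

lemma undecorated_derivable: "locally_derivable (undecorated_folding_tiling S) (folding_tiling S)"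
  unfolding locally_derivable_def
proof (intro exI[of _ 1] conjI allI impI)
  fix x y :: plane
  assume eq: "translate (y - x) ` patch (folding_tiling S) (cball x 1) = patch (folding_tiling S) (cball y 1)"
  let ?f = "\<lambda>t. t\<lparr>mark := None\<rparr> :: tile"
  \<comment> \<open>Tiles through \<open>z\<close> are selected from the decorated patch by their
    supports alone, so forgetting the marks commutes with the translation.\<close>
  have p: "patch (undecorated_folding_tiling S) {z} = ?f ` {t \<in> patch (folding_tiling S) (cball z 1). z \<in> support t}" for z
    unfolding undecorated_folding_tiling_def patch_def by fastforce
  have s: "y \<in> support (translate (y - x) t) \<longleftrightarrow> x \<in> support t" for t
    by (force simp: translate_def image_iff)
  have "{t \<in> patch (folding_tiling S) (cball y 1). y \<in> support t} =
      translate (y - x) ` {t \<in> patch (folding_tiling S) (cball x 1). x \<in> support t}"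
    unfolding eq[symmetric] using s by blast
  moreover have "translate (y - x) (?f t) = ?f (translate (y - x) t)" for t
    by (simp add: translate_def)
  ultimately show "translate (y - x) ` patch (undecorated_folding_tiling S) {x} =
      patch (undecorated_folding_tiling S) {y}"
    unfolding p by (simp add: image_image)
qed simp

theorem theorem3p10:
  fixes S :: "nat \<Rightarrow> folding"
  shows "MLD (folding_tiling S) (undecorated_folding_tiling S)"
  unfolding MLD_def using decorated_derivable undecorated_derivable by blast

end
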